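(* Let $H$ be a finite group. If $G$ is a group in the class $\mathcal{PW}$, then the wreath product $H\wr G$ is also in the class $\mathcal{PW}$. In particular, $H\wr G$ has the Haagerup property.
   Context: A space with walls is a pair $(X,\mathcal{W})$ where $X$ is a set and $\mathcal{W}$ is a family (repetitions allowed) of partitions of $X$ into two classes, called walls, such that for any two distinct points $x,y\in X$ the number $w(x,y)$ of walls separating $x$ from $y$ (i.e. with $x$ and $y$ in different classes; walls counted with multiplicity) is finite. The number $w(x,y)$ is called the wall distance between $x$ and $y$. The class $\mathcal{PW}$ is the class of countable groups $G$ admitting a left-invariant structure of space with walls (i.e. a structure of space with walls on the set $G$ whose family of walls is preserved, with multiplicity, by left translations) such that the corresponding wall distance is proper, i.e. bounded subsets are finite (equivalently, for every $N$ the set $\{g\in G: w(1,g)\le N\}$ is finite). A countable group $G$ has the Haagerup property (is a-T-menable) if it admits an isometric (not necessarily linear) action on a Hilbert space $\mathcal{H}$ that is metrically proper, i.e. $\lim_{g\to\infty}\|x_0-g\cdot x_0\|=+\infty$ for some (equivalently every) $x_0\in\mathcal{H}$. The (standard, restricted) wreath product $H\wr G$ is the semidirect product $H^{(G)}\rtimes G$, where $H^{(G)}$ is the direct sum of copies of $H$ indexed by $G$ (finitely supported functions $G\to H$), on which $G$ acts by shifting. *)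

theory Defs
  imports
    "HOL-Analysis.Abstract_Metric_Spaces"
    "HOL-Library.Disjoint_Sets"
    "HOL-Algebra.Product_Groups"
    "HOL-Algebra.Group_Action"
    "HOL-Algebra.Module"
begin

section \<open>Spaces with walls\<close>

text \<open>A wall is a partition of the set into two (nonempty) classes. A family of walls with
  repetitions allowed is represented by its multiplicity function \<open>m\<close>: the wall \<open>P\<close> occurs
  \<open>m P\<close> times, and its occurrences are the pairs \<open>(P, k)\<close> with \<open>k < m P\<close>. Natural-number
  multiplicities lose no generality: a wall has two nonempty classes, hence separates some pair
  of points, so in a space with walls it can only occur finitely often.\<close>

definition is_wall :: "'a set \<Rightarrow> 'a set set \<Rightarrow> bool" where
  "is_wall X P \<longleftrightarrow> partition_on X P \<and> card P = 2"

definition separates :: "'a set set \<Rightarrow> 'a \<Rightarrow> 'a \<Rightarrow> bool" where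
  "separates P x y \<longleftrightarrow> (\<exists>A\<in>P. \<exists>B\<in>P. A \<noteq> B \<and> x \<in> A \<and> y \<in> B)"

definition separating_walls :: "('a set set \<Rightarrow> nat) \<Rightarrow> 'a \<Rightarrow> 'a \<Rightarrow> ('a set set \<times> nat) set" where
  "separating_walls m x y = {(P, k). k < m P \<and> separates P x y}"

definition space_with_walls :: "'a set \<Rightarrow> ('a set set \<Rightarrow> nat) \<Rightarrow> bool" where
  "space_with_walls X m \<longleftrightarrow>
     (\<forall>P. m P > 0 \<longrightarrow> is_wall X P) \<and>
     (\<forall>x\<in>X. \<forall>y\<in>X. x \<noteq> y \<longrightarrow> finite (separating_walls m x y))"

definition wall_dist :: "('a set set \<Rightarrow> nat) \<Rightarrow> 'a \<Rightarrow> 'a \<Rightarrow> nat" where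
  "wall_dist m x y = card (separating_walls m x y)"

definition proper_wall_dist :: "'a set \<Rightarrow> ('a set set \<Rightarrow> nat) \<Rightarrow> bool" where
  "proper_wall_dist X m \<longleftrightarrow>
     (\<forall>B\<subseteq>X. (\<exists>N. \<forall>x\<in>B. \<forall>y\<in>B. wall_dist m x y \<le> N) \<longrightarrow> finite B)"

definition left_invariant_walls :: "('a, 'b) monoid_scheme \<Rightarrow> ('a set set \<Rightarrow> nat) \<Rightarrow> bool" where
  "left_invariant_walls G m \<longleftrightarrow>
     (\<forall>g\<in>carrier G. \<forall>P. is_wall (carrier G) P \<longrightarrow> m ((\<lambda>A. g <#\<^bsub>G\<^esub> A) ` P) = m P)"

definition class_PW :: "('a, 'b) monoid_scheme \<Rightarrow> bool" where
  "class_PW G \<longleftrightarrow> group G \<and> countable (carrier G) \<and>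
     (\<exists>m. space_with_walls (carrier G) m \<and> left_invariant_walls G m \<and>
          proper_wall_dist (carrier G) m)"

section \<open>The Haagerup property\<close>

definition real_ring :: "real ring" where
  "real_ring = \<lparr>carrier = UNIV, mult = (*), one = 1, zero = 0, add = (+)\<rparr>"

text \<open>The value outside the carrier only serves to meet the unrelativised axioms of
  \<^locale>\<open>Metric_space\<close>.\<close>

definition hilbert_dist ::
    "(real, 'v, 'm) module_scheme \<Rightarrow> ('v \<Rightarrow> 'v \<Rightarrow> real) \<Rightarrow> 'v \<Rightarrow> 'v \<Rightarrow> real" where
  "hilbert_dist V ip x y =
     (if x \<in> carrier V \<and> y \<in> carrier V
      then sqrt (ip (x \<ominus>\<^bsub>V\<^esub> y) (x \<ominus>\<^bsub>V\<^esub> y)) else 0)"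

locale real_hilbert_space = Module.module real_ring V
  for V :: "(real, 'v, 'm) module_scheme" (structure) +
  fixes ip :: "'v \<Rightarrow> 'v \<Rightarrow> real"
  assumes ip_commute: "\<lbrakk>x \<in> carrier V; y \<in> carrier V\<rbrakk> \<Longrightarrow> ip x y = ip y x"
    and ip_add_left: "\<lbrakk>x \<in> carrier V; y \<in> carrier V; z \<in> carrier V\<rbrakk> \<Longrightarrow>
      ip (x \<oplus> y) z = ip x z + ip y z"
    and ip_smult_left: "\<lbrakk>x \<in> carrier V; y \<in> carrier V\<rbrakk> \<Longrightarrow> ip (a \<odot>\<^bsub>V\<^esub> x) y = a * ip x y"
    and ip_pos: "\<lbrakk>x \<in> carrier V; x \<noteq> \<zero>\<rbrakk> \<Longrightarrow> ip x x > 0"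
    and complete: "Metric_space.mcomplete (carrier V) (hilbert_dist V ip)"

text \<open>The action is by isometric bijections, not required to be linear. The group is discrete, so
  \<open>g \<rightarrow> \<infinity>\<close> is convergence along the cofinite filter of the carrier.\<close>

definition proper_isometric_action ::
    "('g, 'b) monoid_scheme \<Rightarrow> (real, 'v, 'm) module_scheme \<Rightarrow> ('v \<Rightarrow> 'v \<Rightarrow> real) \<Rightarrow>
     ('g \<Rightarrow> 'v \<Rightarrow> 'v) \<Rightarrow> bool" where
  "proper_isometric_action G V ip \<phi> \<longleftrightarrow>
     group_action G (carrier V) \<phi> \<and>
     (\<forall>g\<in>carrier G. \<forall>x\<in>carrier V. \<forall>y\<in>carrier V.
        hilbert_dist V ip (\<phi> g x) (\<phi> g y) = hilbert_dist V ip x y) \<and>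
     (\<exists>x\<^sub>0\<in>carrier V. filterlim (\<lambda>g. hilbert_dist V ip x\<^sub>0 (\<phi> g x\<^sub>0)) at_top
        (inf cofinite (principal (carrier G))))"

text \<open>HOL cannot quantify over types, so the Hilbert spaces range over all real Hilbert spaces
  whose carrier is a subset of the type \<^typ>\<open>nat \<Rightarrow> real\<close>, with arbitrary operations. Up to
  isomorphism these include all separable Hilbert spaces. This is no restriction for a countable
  group: an isometric action on a Hilbert space is by affine maps, and it restricts to the closed
  affine span of an orbit, which is separable and invariant. A complex Hilbert space is a real one
  for the real part of the inner product, with the same metric.\<close>

definition haagerup :: "('g, 'b) monoid_scheme \<Rightarrow> bool" where
  "haagerup G \<longleftrightarrow> group G \<and> countable (carrier G) \<and>
     (\<exists>(V :: (real, nat \<Rightarrow> real) module) ip \<phi>.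
        real_hilbert_space V ip \<and> proper_isometric_action G V ip \<phi>)"

section \<open>Wreath products\<close>

definition semidirect_product ::
    "('n, 'a) monoid_scheme \<Rightarrow> ('g, 'b) monoid_scheme \<Rightarrow> ('g \<Rightarrow> 'n \<Rightarrow> 'n) \<Rightarrow> ('n \<times> 'g) monoid" where
  "semidirect_product N G \<alpha> =
     \<lparr>carrier = carrier N \<times> carrier G,
      mult = (\<lambda>(n, g) (n', g'). (n \<otimes>\<^bsub>N\<^esub> \<alpha> g n', g \<otimes>\<^bsub>G\<^esub> g')),
      one = (\<one>\<^bsub>N\<^esub>, \<one>\<^bsub>G\<^esub>)\<rparr>"

definition shift :: "('g, 'b) monoid_scheme \<Rightarrow> 'g \<Rightarrow> ('g \<Rightarrow> 'h) \<Rightarrow> 'g \<Rightarrow> 'h" where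
  "shift G g f = (\<lambda>x\<in>carrier G. f (inv\<^bsub>G\<^esub> g \<otimes>\<^bsub>G\<^esub> x))"

definition wreath_product ::
    "('h, 'a) monoid_scheme \<Rightarrow> ('g, 'b) monoid_scheme \<Rightarrow> (('g \<Rightarrow> 'h) \<times> 'g) monoid" where
  "wreath_product H G = semidirect_product (sum_group (carrier G) (\<lambda>_. H)) G (shift G)"

end

theory Submission
  imports Defs "HOL-Analysis.Infinite_Sum" "HOL-Analysis.L2_Norm"
begin

text \<open>
  For a side \<open>A\<close> of a wall of \<open>G\<close> and a finitely supported \<open>f : G \<rightarrow> H\<close>, let \<open>E(A, f)\<close> be the set of
  all \<open>(f', g)\<close> in \<open>H \<wr> G\<close> with \<open>g \<in> A\<close> and \<open>f' = f\<close> outside \<open>A\<close>. The sets \<open>E(A, f)\<close> and their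
  complements form the walls of \<open>H \<wr> G\<close>; left translations permute them. If \<open>E(A, f\<^sub>0)\<close> separates
  \<open>(f, g)\<close> from \<open>(f', g')\<close>, then \<open>A\<close> separates \<open>g\<close> from \<open>g'\<close> or from a point where \<open>f \<noteq> f'\<close>, and
  \<open>E(A, f\<^sub>0)\<close> is \<open>E(A, f)\<close> or \<open>E(A, f')\<close>; so only finitely many walls separate. Conversely, each
  wall of \<open>G\<close> between \<open>g\<close> and such a point, with side \<open>A\<close> containing \<open>g\<close>, gives the separating
  wall \<open>E(A, f)\<close>. Hence a bound on the wall distance confines \<open>g'\<close> and the support of the
  difference of \<open>f\<close> and \<open>f'\<close> to a ball of \<open>G\<close>, which is finite, and \<open>H\<close> is finite.

  A group with an invariant proper wall structure permutes the sides of the walls, and acts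
  properly on the affine \<open>l\<^sup>2\<close> space through the indicator function of the set of sides that
  contain the identity.
\<close>

no_notation subset_mset (infix "<#" 50)

section \<open>Walls and half-spaces\<close>

text \<open>Passes from the encoding as a set of classes to a single side \<open>A\<close>; later
  arguments handle a wall as a half-space and its complement.\<close>

lemma is_wall_iff:
  "is_wall X P \<longleftrightarrow> (\<exists>A. A \<subseteq> X \<and> A \<noteq> {} \<and> A \<noteq> X \<and> P = {A, X - A})"
proof
  assume P: "is_wall X P"
  then obtain A B where AB: "P = {A, B}" "A \<noteq> B"
    by (auto simp: is_wall_def card_2_iff)
  moreover have "A \<union> B = X" "A \<inter> B = {}" "A \<noteq> {}" "B \<noteq> {}"
    using P AB by (auto simp: is_wall_def partition_on_def disjoint_def)
  ultimately show "\<exists>A. A \<subseteq> X \<and> A \<noteq> {} \<and> A \<noteq> X \<and> P = {A, X - A}"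
    by (intro exI[of _ A]) auto
next
  assume "\<exists>A. A \<subseteq> X \<and> A \<noteq> {} \<and> A \<noteq> X \<and> P = {A, X - A}"
  then obtain A where "A \<subseteq> X" "A \<noteq> {}" "A \<noteq> X" "P = {A, X - A}"
    by blast
  moreover from this have "A \<noteq> X - A" by blast
  ultimately show "is_wall X P"
    by (auto simp: is_wall_def partition_on_def disjoint_def)
qed

lemma is_wallD:
  assumes "is_wall X P" "A \<in> P"
  shows "A \<subseteq> X" "A \<noteq> {}" "A \<noteq> X" "P = {A, X - A}"
  using assms by (auto simp: is_wall_iff)

lemma separates_iff:
  assumes "is_wall X P" "A \<in> P" "x \<in> X" "y \<in> X"
  shows "separates P x y \<longleftrightarrow> (x \<in> A) \<noteq> (y \<in> A)"
  using is_wallD[OF assms(1,2)] assms(3,4) by (auto simp: separates_def)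

lemma wall_side:
  assumes "is_wall X P" "x \<in> X"
  obtains A where "A \<in> P" "x \<in> A"
  using assms by (auto simp: is_wall_def partition_on_def)

text \<open>If a wall separates \<open>x\<close> from \<open>z\<close>, then \<open>y\<close> lies
  opposite one of the two.\<close>

lemma separating_walls_subset_Un:
  assumes "space_with_walls X m" "x \<in> X" "y \<in> X" "z \<in> X"
  shows "separating_walls m x z \<subseteq> separating_walls m x y \<union> separating_walls m y z"
proof
  fix p assume "p \<in> separating_walls m x z"
  then obtain P k where p: "p = (P, k)" "k < m P" "separates P x z"
    by (auto simp: separating_walls_def)
  then have P: "is_wall X P"
    using assms(1) by (auto simp: space_with_walls_def)
  obtain A where "A \<in> P" "x \<in> A"
    using wall_side[OF P assms(2)] .
  with p P assms show "p \<in> separating_walls m x y \<union> separating_walls m y z"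
    by (auto simp: separating_walls_def separates_iff[OF P \<open>A \<in> P\<close>])
qed

lemma finite_separating_walls:
  assumes "space_with_walls X m" "x \<in> X" "y \<in> X"
  shows "finite (separating_walls m x y)"
proof (cases "x = y")
  case True
  \<comment> \<open>Finiteness is demanded for distinct points only. Equal points are never
    separated, as the classes of a wall are disjoint.\<close>
  have "separating_walls m x y = {}"
  proof (rule equals0I)
    fix p assume "p \<in> separating_walls m x y"
    then obtain P where P: "m P > 0" "separates P x y"
      by (auto simp: separating_walls_def dest: gr_implies_not0)
    then have "is_wall X P"
      using assms(1) by (auto simp: space_with_walls_def)
    with P True show False
      by (auto simp: separates_def is_wall_def partition_on_def disjoint_def)
  qed
  then show ?thesis by simp
next
  case False
  then show ?thesis
    using assms by (auto simp: space_with_walls_def)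
qed

lemma wall_dist_triangle:
  assumes "space_with_walls X m" "x \<in> X" "y \<in> X" "z \<in> X"
  shows "wall_dist m x z \<le> wall_dist m x y + wall_dist m y z"
proof -
  have "wall_dist m x z \<le> card (separating_walls m x y \<union> separating_walls m y z)"
    unfolding wall_dist_def using assms
    by (intro card_mono separating_walls_subset_Un finite_UnI finite_separating_walls)
  also have "\<dots> \<le> wall_dist m x y + wall_dist m y z"
    unfolding wall_dist_def by (rule card_Un_le)
  finally show ?thesis .
qed

lemma wall_dist_commute: "wall_dist m x y = wall_dist m y x"
proof -
  have "separating_walls m x y = separating_walls m y x"
    by (auto simp: separating_walls_def separates_def)
  then show ?thesis by (simp add: wall_dist_def)
qed

text \<open>Properness speaks of sets of bounded diameter, and the triangle inequality through the
  centre bounds the diameter of this ball by \<open>2 * N\<close>.\<close>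

lemma finite_wall_ball:
  assumes m: "space_with_walls X m" "proper_wall_dist X m" and x: "x \<in> X"
  shows "finite {y \<in> X. wall_dist m x y \<le> N}"
proof -
  let ?B = "{y \<in> X. wall_dist m x y \<le> N}"
  have "wall_dist m y z \<le> 2 * N" if "y \<in> ?B" "z \<in> ?B" for y z
    using wall_dist_triangle[OF m(1), of y x z] wall_dist_commute[of m x y] that x by simp
  then have "\<exists>N. \<forall>y\<in>?B. \<forall>z\<in>?B. wall_dist m y z \<le> N" by blast
  moreover have "?B \<subseteq> X" by blast
  ultimately show ?thesis
    using m(2) unfolding proper_wall_dist_def by blast
qed

section \<open>Left translates of subsets and of walls\<close>

context group
begin

lemma l_coset_eq_image: "g <# A = (\<lambda>x. g \<otimes> x) ` A"
  by (auto simp: l_coset_def)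

lemma mem_l_coset_iff:
  assumes "g \<in> carrier G" "A \<subseteq> carrier G" "x \<in> carrier G"
  shows "g \<otimes> x \<in> g <# A \<longleftrightarrow> x \<in> A"
  using assms by (auto simp: l_coset_eq_image subset_iff)

lemma mem_l_coset_iff_inv:
  assumes "g \<in> carrier G" "A \<subseteq> carrier G" "x \<in> carrier G"
  shows "x \<in> g <# A \<longleftrightarrow> inv g \<otimes> x \<in> A"
  using mem_l_coset_iff[of g A "inv g \<otimes> x"] assms by (simp add: m_assoc[symmetric])

lemma l_coset_Diff:
  assumes g: "g \<in> carrier G" and A: "A \<subseteq> carrier G"
  shows "g <# (carrier G - A) = carrier G - (g <# A)"
proof -
  have sub: "g <# B \<subseteq> carrier G" if "B \<subseteq> carrier G" for B
    using l_coset_subset_G[OF that g] .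
  have "x \<in> g <# (carrier G - A) \<longleftrightarrow> x \<in> carrier G - (g <# A)" if "x \<in> carrier G" for x
    using that assms by (simp add: mem_l_coset_iff_inv)
  with sub[of A] sub[of "carrier G - A"] A show ?thesis by blast
qed

lemma l_coset_inj_on:
  assumes "g \<in> carrier G"
  shows "inj_on (\<lambda>A. g <# A) (Pow (carrier G))"
proof (rule inj_onI)
  fix A B assume AB: "A \<in> Pow (carrier G)" "B \<in> Pow (carrier G)" and eq: "g <# A = g <# B"
  then have "inv g <# (g <# A) = inv g <# (g <# B)" by simp
  with AB assms show "A = B" by (simp add: lcos_m_assoc lcos_mult_one)
qed

lemma is_wall_l_coset:
  assumes g: "g \<in> carrier G" and P: "is_wall (carrier G) P"
  shows "is_wall (carrier G) ((\<lambda>A. g <# A) ` P)"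
proof -
  obtain A where A: "A \<subseteq> carrier G" "A \<noteq> {}" "A \<noteq> carrier G" "P = {A, carrier G - A}"
    using P by (auto simp: is_wall_iff)
  \<comment> \<open>The empty set is its own translate; taking complements, so is the whole
    group.\<close>
  have "g <# carrier G = carrier G" using l_coset_Diff[OF g, of "{}"] by (simp add: l_coset_def)
  then have "g <# A \<noteq> carrier G"
    using inj_onD[OF l_coset_inj_on[OF g], of A "carrier G"] A by auto
  moreover have "g <# A \<subseteq> carrier G" using l_coset_subset_G[OF A(1) g] .
  moreover have "g <# A \<noteq> {}" using A(2) by (simp add: l_coset_eq_image)
  moreover have "(\<lambda>A. g <# A) ` P = {g <# A, carrier G - (g <# A)}"
    using A by (simp add: l_coset_Diff[OF g])
  ultimately show ?thesis unfolding is_wall_iff by blast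
qed

text \<open>Left invariance is stated for genuine walls. If \<open>A\<close> is empty or the whole
  group, so is its translate, and both multiplicities are 0; thus the rule applies to every
  subset.\<close>

lemma left_invariant_halfspace:
  assumes "left_invariant_walls G m" "space_with_walls (carrier G) m"
    and g: "g \<in> carrier G" and A: "A \<subseteq> carrier G"
  shows "m {g <# A, carrier G - (g <# A)} = m {A, carrier G - A}"
proof (cases "is_wall (carrier G) {A, carrier G - A}")
  case True
  then have "m ((\<lambda>A. g <# A) ` {A, carrier G - A}) = m {A, carrier G - A}"
    using assms(1) g unfolding left_invariant_walls_def by blast
  then show ?thesis using g A by (simp add: l_coset_Diff)
next
  case False
  have "\<not> is_wall (carrier G) {g <# A, carrier G - (g <# A)}"
  proof
    assume "is_wall (carrier G) {g <# A, carrier G - (g <# A)}"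
    then have "is_wall (carrier G) ((\<lambda>B. inv g <# B) ` {g <# A, g <# (carrier G - A)})"
      using g A by (intro is_wall_l_coset) (auto simp: l_coset_Diff)
    with g A False show False by (simp add: lcos_m_assoc lcos_mult_one)
  qed
  with False assms(2) have "m {g <# A, carrier G - (g <# A)} = 0" "m {A, carrier G - A} = 0"
    unfolding space_with_walls_def by blast+
  then show ?thesis by simp
qed

end

section \<open>Wreath products\<close>

lemma shift_apply: "x \<in> carrier G \<Longrightarrow> shift G g f x = f (inv\<^bsub>G\<^esub> g \<otimes>\<^bsub>G\<^esub> x)"
  by (simp add: shift_def)

section \<open>The wreath product as a countable group\<close>

context
  fixes H :: "('h, 'c) monoid_scheme" and G :: "('g, 'd) monoid_scheme" (structure)
  assumes H: "group H" and G: "group G"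
begin

interpretation H: group H by (rule H)
interpretation G: group G by (rule G)

private abbreviation (input) "base \<equiv> sum_group (carrier G) (\<lambda>_. H)"
private abbreviation (input) "W \<equiv> wreath_product H G"

lemma carrier_base:
  "carrier base = {f \<in> carrier G \<rightarrow>\<^sub>E carrier H. finite {x \<in> carrier G. f x \<noteq> \<one>\<^bsub>H\<^esub>}}"
  by (rule carrier_sum_group) (rule H)

lemma group_base: "group base"
  by (rule sum_group) (rule H)

lemma base_closed: "f \<in> carrier base \<Longrightarrow> x \<in> carrier G \<Longrightarrow> f x \<in> carrier H"
  unfolding carrier_base by auto

lemma base_ext:
  assumes "f \<in> carrier base" "f' \<in> carrier base" "\<And>x. x \<in> carrier G \<Longrightarrow> f x = f' x"
  shows "f = f'"
  using assms unfolding carrier_base by (auto intro: PiE_ext)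

text \<open>The support of the shifted function is contained in the translate by \<open>g\<close> of
  the support of \<open>f\<close>.\<close>

lemma shift_closed:
  assumes "g \<in> carrier G" "f \<in> carrier base"
  shows "shift G g f \<in> carrier base"
proof -
  have "finite ((\<lambda>x. g \<otimes> x) ` {x \<in> carrier G. f x \<noteq> \<one>\<^bsub>H\<^esub>})"
    using assms(2) unfolding carrier_base by simp
  moreover have "{x \<in> carrier G. shift G g f x \<noteq> \<one>\<^bsub>H\<^esub>} \<subseteq>
      (\<lambda>x. g \<otimes> x) ` {x \<in> carrier G. f x \<noteq> \<one>\<^bsub>H\<^esub>}"
  proof
    fix x assume "x \<in> {x \<in> carrier G. shift G g f x \<noteq> \<one>\<^bsub>H\<^esub>}"
    with assms(1) show "x \<in> (\<lambda>x. g \<otimes> x) ` {x \<in> carrier G. f x \<noteq> \<one>\<^bsub>H\<^esub>}"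
      by (intro image_eqI[of _ _ "inv g \<otimes> x"]) (auto simp: shift_apply simp flip: G.m_assoc)
  qed
  ultimately have "finite {x \<in> carrier G. shift G g f x \<noteq> \<one>\<^bsub>H\<^esub>}"
    by (rule finite_subset[rotated])
  with assms show ?thesis
    using base_closed[OF assms(2)] unfolding carrier_base by (auto simp: shift_def)
qed

lemma shift_mult:
  assumes "g \<in> carrier G" "h \<in> carrier G"
  shows "shift G (g \<otimes> h) f = shift G g (shift G h f)"
  using assms by (auto simp: shift_def fun_eq_iff G.inv_mult_group G.m_assoc)

lemma shift_one:
  assumes "f \<in> carrier base"
  shows "shift G \<one> f = f"
  using assms by (intro base_ext shift_closed) (auto simp: shift_apply)

lemma carrier_wreath: "carrier W = carrier base \<times> carrier G"
  by (simp add: wreath_product_def semidirect_product_def)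

lemma mult_wreath:
  "(f, g) \<otimes>\<^bsub>W\<^esub> (f', g') = ((\<lambda>x\<in>carrier G. f x \<otimes>\<^bsub>H\<^esub> shift G g f' x), g \<otimes> g')"
  by (simp add: wreath_product_def semidirect_product_def)

lemma one_wreath: "\<one>\<^bsub>W\<^esub> = ((\<lambda>x\<in>carrier G. \<one>\<^bsub>H\<^esub>), \<one>)"
  by (simp add: wreath_product_def semidirect_product_def)

lemma shift_base_mult:
  assumes "g \<in> carrier G"
  shows "shift G g (\<lambda>x\<in>carrier G. f x \<otimes>\<^bsub>H\<^esub> f' x) = (\<lambda>x\<in>carrier G. shift G g f x \<otimes>\<^bsub>H\<^esub> shift G g f' x)"
  using assms by (auto simp: shift_def fun_eq_iff)

lemma base_mult_closed:
  assumes "f \<in> carrier base" "f' \<in> carrier base"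
  shows "(\<lambda>x\<in>carrier G. f x \<otimes>\<^bsub>H\<^esub> f' x) \<in> carrier base"
  using monoid.m_closed[OF group.is_monoid[OF group_base] assms] by simp

lemma group_wreath: "group W"
proof (rule groupI)
  fix v w assume "v \<in> carrier W" "w \<in> carrier W"
  then show "v \<otimes>\<^bsub>W\<^esub> w \<in> carrier W"
    by (cases v; cases w) (simp add: carrier_wreath mult_wreath base_mult_closed shift_closed)
next
  show "\<one>\<^bsub>W\<^esub> \<in> carrier W"
    using monoid.one_closed[OF group.is_monoid[OF group_base]]
    by (simp add: carrier_wreath one_wreath)
next
  fix u v w assume uvw: "u \<in> carrier W" "v \<in> carrier W" "w \<in> carrier W"
  obtain f1 g1 f2 g2 f3 g3 where eq: "u = (f1, g1)" "v = (f2, g2)" "w = (f3, g3)"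
    by (metis surj_pair)
  have *: "f1 \<in> carrier base" "f2 \<in> carrier base" "f3 \<in> carrier base"
    "g1 \<in> carrier G" "g2 \<in> carrier G" "g3 \<in> carrier G"
    using uvw by (auto simp: eq carrier_wreath)
  then have "shift G g1 f2 \<in> carrier base" "shift G g1 (shift G g2 f3) \<in> carrier base"
    by (auto intro: shift_closed)
  with * show "u \<otimes>\<^bsub>W\<^esub> v \<otimes>\<^bsub>W\<^esub> w = u \<otimes>\<^bsub>W\<^esub> (v \<otimes>\<^bsub>W\<^esub> w)"
    by (simp add: eq mult_wreath shift_base_mult shift_mult G.m_assoc)
      (auto simp: fun_eq_iff H.m_assoc base_closed)
next
  fix w assume "w \<in> carrier W"
  then obtain f g where w: "w = (f, g)" "f \<in> carrier base" "g \<in> carrier G"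
    by (auto simp: carrier_wreath)
  have "(\<lambda>x\<in>carrier G. \<one>\<^bsub>H\<^esub> \<otimes>\<^bsub>H\<^esub> f x) = f"
    using monoid.l_one[OF group.is_monoid[OF group_base] w(2)] by (simp cong: restrict_cong)
  with w show "\<one>\<^bsub>W\<^esub> \<otimes>\<^bsub>W\<^esub> w = w"
    by (simp add: one_wreath mult_wreath shift_one cong: restrict_cong)
next
  fix w assume "w \<in> carrier W"
  then obtain f g where w: "w = (f, g)" "f \<in> carrier base" "g \<in> carrier G"
    by (auto simp: carrier_wreath)
  \<comment> \<open>The base component of the product of \<open>(f', inv g)\<close> and
    \<open>w\<close> is \<open>f'\<close> times the shift of \<open>f\<close> by
    \<open>inv g\<close>; being a left inverse forces this choice.\<close>
  define f' where "f' = inv\<^bsub>base\<^esub> (shift G (inv g) f)"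
  have s: "shift G (inv g) f \<in> carrier base" using w by (intro shift_closed) auto
  have "f' \<in> carrier base"
    unfolding f'_def by (rule group.inv_closed[OF group_base s])
  moreover have "f' \<otimes>\<^bsub>base\<^esub> shift G (inv g) f = \<one>\<^bsub>base\<^esub>"
    unfolding f'_def by (rule group.l_inv[OF group_base s])
  ultimately show "\<exists>v\<in>carrier W. v \<otimes>\<^bsub>W\<^esub> w = \<one>\<^bsub>W\<^esub>"
    using w by (intro bexI[of _ "(f', inv g)"]) (simp_all add: carrier_wreath mult_wreath one_wreath)
qed

interpretation W: group W by (rule group_wreath)

text \<open>A finitely supported function is determined by its graph over the support, a finite
  subset of the countable set \<open>carrier G \<times> carrier H\<close>.\<close>

lemma countable_wreath:
  assumes "countable (carrier G)" "countable (carrier H)"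
  shows "countable (carrier W)"
proof -
  let ?graph = "\<lambda>f. {(x, f x) |x. x \<in> carrier G \<and> f x \<noteq> \<one>\<^bsub>H\<^esub>}"
  have "countable (?graph ` carrier base)"
  proof (rule countable_subset)
    show "?graph ` carrier base \<subseteq> {A. finite A \<and> A \<subseteq> carrier G \<times> carrier H}"
    proof clarify
      fix f assume f: "f \<in> carrier base"
      have "?graph f = (\<lambda>x. (x, f x)) ` {x \<in> carrier G. f x \<noteq> \<one>\<^bsub>H\<^esub>}" by blast
      moreover have "finite {x \<in> carrier G. f x \<noteq> \<one>\<^bsub>H\<^esub>}"
        using f unfolding carrier_base by blast
      ultimately have "finite (?graph f)" by simp
      then show "finite (?graph f) \<and> ?graph f \<subseteq> carrier G \<times> carrier H"
        using base_closed[OF f] by blast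
    qed
    show "countable {A. finite A \<and> A \<subseteq> carrier G \<times> carrier H}"
      using assms by (intro countable_Collect_finite_subset countable_SIGMA)
  qed
  moreover have "inj_on ?graph (carrier base)"
  proof (rule inj_onI)
    fix f f' assume f: "f \<in> carrier base" "f' \<in> carrier base" "?graph f = ?graph f'"
    show "f = f'"
    proof (rule base_ext[OF f(1,2)])
      fix x assume "x \<in> carrier G"
      \<comment> \<open>The graphs record all values other than the identity; a point missing from
        both carries the identity under both functions.\<close>
      have "f x = y \<longleftrightarrow> f' x = y" if "y \<noteq> \<one>\<^bsub>H\<^esub>" for y
      proof -
        have "(x, y) \<in> ?graph f \<longleftrightarrow> (x, y) \<in> ?graph f'" using f(3) by simp
        then show ?thesis using \<open>x \<in> carrier G\<close> that by auto
      qed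
      then show "f x = f' x" by metis
    qed
  qed
  ultimately have "countable (carrier base)" by (rule countable_image_inj_on)
  with assms show ?thesis by (simp add: carrier_wreath)
qed

section \<open>Half-spaces of the wreath product and their translates\<close>

definition halfspace :: "'g set \<Rightarrow> ('g \<Rightarrow> 'h) \<Rightarrow> (('g \<Rightarrow> 'h) \<times> 'g) set" where
  "halfspace A f = {(f', g). f' \<in> carrier base \<and> g \<in> A \<and> (\<forall>x\<in>carrier G - A. f' x = f x)}"

text \<open>\<open>A\<close> may be empty or all of \<open>carrier G\<close>, so that translation
  stays inside this family without side conditions; in a space with walls such sides get
  multiplicity 0 below.\<close>

definition halfspaces :: "(('g \<Rightarrow> 'h) \<times> 'g) set set" where
  "halfspaces = {halfspace A f |A f. A \<subseteq> carrier G \<and> f \<in> carrier base}"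

text \<open>A half-space \<open>halfspace A f\<close> remembers \<open>A\<close>, namely as its projection to \<open>G\<close>; it inherits the
  multiplicity of the wall of \<open>A\<close>. A wall of the wreath product can have both of its sides among
  the half-spaces (for trivial \<open>H\<close>), whence the sum over the sides.\<close>

definition halfspace_multiplicity :: "('g set set \<Rightarrow> nat) \<Rightarrow> (('g \<Rightarrow> 'h) \<times> 'g) set \<Rightarrow> nat" where
  "halfspace_multiplicity m E = (if E \<in> halfspaces then m {snd ` E, carrier G - snd ` E} else 0)"

definition wreath_walls ::
    "('g set set \<Rightarrow> nat) \<Rightarrow> (('g \<Rightarrow> 'h) \<times> 'g) set set \<Rightarrow> nat" where
  "wreath_walls m P = (if is_wall (carrier W) P then \<Sum>E\<in>P. halfspace_multiplicity m E else 0)"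

lemma snd_halfspace: "f \<in> carrier base \<Longrightarrow> snd ` halfspace A f = A"
  by (force simp: halfspace_def)

lemma halfspace_subset: "A \<subseteq> carrier G \<Longrightarrow> halfspace A f \<subseteq> carrier W"
  by (auto simp: halfspace_def carrier_wreath)

text \<open>Any member supplies a reference function, since only the values off \<open>A\<close>
  matter. A half-space containing exactly one of two points can thus be based at the function of
  that point.\<close>

lemma halfspace_eqI: "(f', g) \<in> halfspace A f \<Longrightarrow> halfspace A f = halfspace A f'"
  by (auto simp: halfspace_def)

text \<open>Left multiplication by \<open>f0 x\<close> cancels pointwise, and the shift by
  \<open>g0\<close> moves the condition on the complement of \<open>A\<close> to the complement of
  \<open>g0 <# A\<close>.\<close>

lemma mult_mem_halfspace_iff:
  assumes "f0 \<in> carrier base" "g0 \<in> carrier G" "A \<subseteq> carrier G" "f \<in> carrier base" "v \<in> carrier W"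
  shows "(f0, g0) \<otimes>\<^bsub>W\<^esub> v \<in> halfspace (g0 <# A) (\<lambda>x\<in>carrier G. f0 x \<otimes>\<^bsub>H\<^esub> shift G g0 f x) \<longleftrightarrow>
    v \<in> halfspace A f"
proof -
  obtain f' g where v: "v = (f', g)" "f' \<in> carrier base" "g \<in> carrier G"
    using assms(5) by (auto simp: carrier_wreath)
  have "(\<forall>x\<in>carrier G - (g0 <# A). f0 x \<otimes>\<^bsub>H\<^esub> shift G g0 f' x = f0 x \<otimes>\<^bsub>H\<^esub> shift G g0 f x) \<longleftrightarrow>
      (\<forall>x\<in>g0 <# (carrier G - A). shift G g0 f' x = shift G g0 f x)"
    unfolding G.l_coset_Diff[OF assms(2,3)]
    using assms v by (intro ball_cong refl H.Units_l_cancel) (auto intro: base_closed shift_closed)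
  also have "\<dots> \<longleftrightarrow> (\<forall>x\<in>carrier G - A. f' x = f x)"
    unfolding G.l_coset_eq_image using assms(2) by (simp add: shift_apply flip: G.m_assoc)
  finally show ?thesis
    using assms v by (auto simp: halfspace_def mult_wreath G.mem_l_coset_iff base_mult_closed shift_closed)
qed

lemma l_coset_halfspace:
  assumes "f0 \<in> carrier base" "g0 \<in> carrier G" "A \<subseteq> carrier G" "f \<in> carrier base"
  shows "(f0, g0) <#\<^bsub>W\<^esub> halfspace A f =
    halfspace (g0 <# A) (\<lambda>x\<in>carrier G. f0 x \<otimes>\<^bsub>H\<^esub> shift G g0 f x)" (is "?l = ?r")
proof (rule subset_antisym)
  have w: "(f0, g0) \<in> carrier W" using assms by (simp add: carrier_wreath)
  show "?l \<subseteq> ?r"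
    unfolding W.l_coset_eq_image
    using mult_mem_halfspace_iff[OF assms] halfspace_subset[OF assms(3)] by blast
  show "?r \<subseteq> ?l"
  proof
    fix v assume v: "v \<in> ?r"
    have "g0 <# A \<subseteq> carrier G" using assms by (simp add: G.l_coset_subset_G)
    then have vW: "v \<in> carrier W" using v halfspace_subset by blast
    \<comment> \<open>The reverse inclusion pulls \<open>v\<close> back by the inverse and uses the
      membership equivalence there.\<close>
    then have eq: "v = (f0, g0) \<otimes>\<^bsub>W\<^esub> (inv\<^bsub>W\<^esub> (f0, g0) \<otimes>\<^bsub>W\<^esub> v)"
      using w by (simp flip: W.m_assoc)
    with v vW w have "inv\<^bsub>W\<^esub> (f0, g0) \<otimes>\<^bsub>W\<^esub> v \<in> halfspace A f"
      using mult_mem_halfspace_iff[OF assms, of "inv\<^bsub>W\<^esub> (f0, g0) \<otimes>\<^bsub>W\<^esub> v"] by simp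
    with eq show "v \<in> ?l" unfolding W.l_coset_eq_image by blast
  qed
qed

lemma halfspaces_l_coset:
  assumes "w \<in> carrier W" "E \<in> halfspaces"
  shows "w <#\<^bsub>W\<^esub> E \<in> halfspaces" "snd ` (w <#\<^bsub>W\<^esub> E) = snd w <# (snd ` E)"
proof -
  obtain f0 g0 where w: "w = (f0, g0)" "f0 \<in> carrier base" "g0 \<in> carrier G"
    using assms(1) by (auto simp: carrier_wreath)
  obtain A f where E: "E = halfspace A f" "A \<subseteq> carrier G" "f \<in> carrier base"
    using assms(2) by (auto simp: halfspaces_def)
  let ?f = "\<lambda>x\<in>carrier G. f0 x \<otimes>\<^bsub>H\<^esub> shift G g0 f x"
  have f: "?f \<in> carrier base" using w E by (intro base_mult_closed shift_closed)
  have eq: "w <#\<^bsub>W\<^esub> E = halfspace (g0 <# A) ?f"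
    unfolding w E by (rule l_coset_halfspace) fact+
  show "w <#\<^bsub>W\<^esub> E \<in> halfspaces"
    unfolding eq halfspaces_def using f G.l_coset_subset_G[OF E(2) w(3)] by blast
  show "snd ` (w <#\<^bsub>W\<^esub> E) = snd w <# (snd ` E)"
    unfolding eq snd_halfspace[OF f] using E w by (simp add: snd_halfspace)
qed

text \<open>Projection to \<open>G\<close> turns translation by \<open>w\<close> into translation by
  \<open>snd w\<close>, under which \<open>m\<close> is invariant. A set that is not a half-space
  stays so, since translating back preserves half-spaces.\<close>

lemma halfspace_multiplicity_l_coset:
  assumes m: "space_with_walls (carrier G) m" "left_invariant_walls G m"
    and w: "w \<in> carrier W" and E: "E \<subseteq> carrier W"
  shows "halfspace_multiplicity m (w <#\<^bsub>W\<^esub> E) = halfspace_multiplicity m E"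
proof (cases "E \<in> halfspaces")
  case True
  have "snd w \<in> carrier G" "snd ` E \<subseteq> carrier G" using w E by (auto simp: carrier_wreath)
  with True show ?thesis
    using halfspaces_l_coset[OF w True] G.left_invariant_halfspace[OF m(2,1)]
    by (simp add: halfspace_multiplicity_def)
next
  case False
  have "w <#\<^bsub>W\<^esub> E \<notin> halfspaces"
  proof
    assume "w <#\<^bsub>W\<^esub> E \<in> halfspaces"
    then have "inv\<^bsub>W\<^esub> w <#\<^bsub>W\<^esub> (w <#\<^bsub>W\<^esub> E) \<in> halfspaces"
      by (rule halfspaces_l_coset(1)[OF W.inv_closed[OF w]])
    with False w E show False by (simp add: W.lcos_m_assoc W.lcos_mult_one)
  qed
  with False show ?thesis by (simp add: halfspace_multiplicity_def)
qed

lemma left_invariant_wreath_walls: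
  assumes "space_with_walls (carrier G) m" "left_invariant_walls G m"
  shows "left_invariant_walls W (wreath_walls m)"
  unfolding left_invariant_walls_def
proof (intro ballI allI impI)
  fix w P assume w: "w \<in> carrier W" and P: "is_wall (carrier W) P"
  have sub: "P \<subseteq> Pow (carrier W)" using is_wallD(1)[OF P] by blast
  have "(\<Sum>E\<in>(\<lambda>E. w <#\<^bsub>W\<^esub> E) ` P. halfspace_multiplicity m E) = (\<Sum>E\<in>P. halfspace_multiplicity m (w <#\<^bsub>W\<^esub> E))"
    by (rule sum.reindex_cong[OF inj_on_subset[OF W.l_coset_inj_on[OF w] sub]]) auto
  also have "\<dots> = (\<Sum>E\<in>P. halfspace_multiplicity m E)"
    using sub by (intro sum.cong halfspace_multiplicity_l_coset[OF assms w]) auto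
  finally show "wreath_walls m ((\<lambda>E. w <#\<^bsub>W\<^esub> E) ` P) = wreath_walls m P"
    using P W.is_wall_l_coset[OF w P] by (simp add: wreath_walls_def)
qed

section \<open>The wall distance of the wreath product: finiteness and properness\<close>

lemma is_wall_halfspace:
  assumes A: "is_wall (carrier G) {A, carrier G - A}" and f: "f \<in> carrier base"
  shows "is_wall (carrier W) {halfspace A f, carrier W - halfspace A f}"
proof -
  have A': "A \<subseteq> carrier G" "A \<noteq> {}" "A \<noteq> carrier G"
    using is_wallD[OF A, of A] by auto
  then obtain x y where "x \<in> A" "y \<in> carrier G" "y \<notin> A" by blast
  then have "(f, x) \<in> halfspace A f" "(f, y) \<in> carrier W - halfspace A f"
    using f by (auto simp: halfspace_def carrier_wreath)
  then show ?thesis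
    unfolding is_wall_iff using halfspace_subset[OF A'(1)] by blast
qed

lemma space_with_walls_wreath:
  assumes m: "space_with_walls (carrier G) m"
  shows "space_with_walls (carrier W) (wreath_walls m)"
  unfolding space_with_walls_def
proof (intro conjI allI impI ballI)
  fix P assume "wreath_walls m P > 0"
  then show "is_wall (carrier W) P" by (simp add: wreath_walls_def split: if_splits)
next
  fix v w assume vw: "v \<in> carrier W" "w \<in> carrier W"
  obtain f g f' g' where eq: "v = (f, g)" "w = (f', g')"
    and c: "f \<in> carrier base" "g \<in> carrier G" "f' \<in> carrier base" "g' \<in> carrier G"
    using vw by (auto simp: carrier_wreath)
  \<comment> \<open>\<open>T\<close> collects the points that a separating half-space can cut off
    from \<open>g\<close>. \<open>\<A>\<close> consists of both sides of the finitely many walls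
    between \<open>g\<close> and points of \<open>T\<close>, and \<open>\<E>\<close> of the
    half-spaces over them based at \<open>f\<close> or \<open>f'\<close>.\<close>
  define T where "T = {g'} \<union> {x \<in> carrier G. f x \<noteq> f' x}"
  define \<A> where "\<A> = (\<Union>x\<in>T. \<Union>(P, k)\<in>separating_walls m g x. P)"
  define \<E> where "\<E> = (\<Union>A\<in>\<A>. {halfspace A f, halfspace A f'})"
  have "{x \<in> carrier G. f x \<noteq> f' x} \<subseteq>
      {x \<in> carrier G. f x \<noteq> \<one>\<^bsub>H\<^esub>} \<union> {x \<in> carrier G. f' x \<noteq> \<one>\<^bsub>H\<^esub>}" by auto
  then have "finite T"
    using c unfolding carrier_base T_def by (auto elim: finite_subset)
  moreover have "finite P" if "(P, k) \<in> separating_walls m x y" for P k x y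
  proof -
    have "is_wall (carrier G) P"
      using that m by (auto simp: separating_walls_def space_with_walls_def)
    then show ?thesis by (auto simp: is_wall_iff)
  qed
  ultimately have "finite \<A>"
    unfolding \<A>_def using finite_separating_walls[OF m c(2)] c(4)
    by (intro finite_UN_I) (auto simp: T_def)
  then have "finite \<E>" unfolding \<E>_def by simp
  have "separating_walls (wreath_walls m) v w \<subseteq>
      (\<Union>E\<in>\<E>. {({E, carrier W - E}, k) |k. k < wreath_walls m {E, carrier W - E}})"
  proof clarify
    fix P k assume P: "(P, k) \<in> separating_walls (wreath_walls m) v w"
    then have k: "k < wreath_walls m P" and sep: "separates P v w"
      by (auto simp: separating_walls_def)
    then have wall: "is_wall (carrier W) P" by (simp add: wreath_walls_def split: if_splits)
    \<comment> \<open>A positive sum has a nonzero summand: some side of the wall is a half-space of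
      positive multiplicity.\<close>
    with k have "(\<Sum>E\<in>P. halfspace_multiplicity m E) \<noteq> 0" by (simp add: wreath_walls_def)
    then obtain E where E: "E \<in> P" "halfspace_multiplicity m E \<noteq> 0"
      by (meson sum.neutral)
    then obtain A f0 where A: "E = halfspace A f0" "A \<subseteq> carrier G" "f0 \<in> carrier base"
      by (auto simp: halfspace_multiplicity_def halfspaces_def split: if_splits)
    with E(2) have mA: "m {A, carrier G - A} > 0"
      by (simp add: halfspace_multiplicity_def snd_halfspace split: if_splits)
    then have wallA: "is_wall (carrier G) {A, carrier G - A}"
      using m by (auto simp: space_with_walls_def)
    have vwE: "(v \<in> E) \<noteq> (w \<in> E)"
      using sep separates_iff[OF wall E(1) vw] by simp
    \<comment> \<open>\<open>E\<close> contains one of the two points, whose function can replace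
      \<open>f0\<close>.\<close>
    then have f0: "E = halfspace A f \<or> E = halfspace A f'"
      unfolding eq using A(1) halfspace_eqI by metis
    \<comment> \<open>Otherwise \<open>g\<close> and \<open>g'\<close> lie on the same side. If
      outside \<open>A\<close>, neither point is in \<open>E\<close>; if inside, \<open>f\<close>
      and \<open>f'\<close> agree off \<open>A\<close>, so both or neither are.\<close>
    have "\<exists>x\<in>T. (g \<in> A) \<noteq> (x \<in> A)"
    proof (rule ccontr)
      assume "\<not> ?thesis"
      then have same: "g \<in> A \<longleftrightarrow> x \<in> A" if "x \<in> T" for x using that by blast
      then have "g \<in> A \<longleftrightarrow> g' \<in> A" by (simp add: T_def)
      moreover have "f x = f' x" if "g \<in> A" "x \<in> carrier G - A" for x
        using same[of x] that by (auto simp: T_def)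
      ultimately have "v \<in> E \<longleftrightarrow> w \<in> E"
        unfolding eq A(1) using c by (auto simp: halfspace_def)
      with vwE show False by simp
    qed
    then obtain x where x: "x \<in> T" "(g \<in> A) \<noteq> (x \<in> A)" by blast
    then have "x \<in> carrier G" using c by (auto simp: T_def)
    \<comment> \<open>Copy 0 exists because the multiplicity is positive, and a single copy puts the
      sides into \<open>\<A>\<close>.\<close>
    with x(2) have "({A, carrier G - A}, 0) \<in> separating_walls m g x"
      using mA separates_iff[OF wallA, of A g x] c(2) by (simp add: separating_walls_def)
    with x(1) have "A \<in> \<A>" unfolding \<A>_def by blast
    with f0 have "E \<in> \<E>" unfolding \<E>_def by blast
    with k is_wallD(4)[OF wall E(1)] show "(P, k) \<in>
        (\<Union>E\<in>\<E>. {({E, carrier W - E}, k) |k. k < wreath_walls m {E, carrier W - E}})"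
      by blast
  qed
  moreover have "finite (\<Union>E\<in>\<E>. {({E, carrier W - E}, k) |k. k < wreath_walls m {E, carrier W - E}})"
    using \<open>finite \<E>\<close> by auto
  ultimately show "finite (separating_walls (wreath_walls m) v w)"
    by (rule finite_subset)
qed

text \<open>A wall of \<open>G\<close> between \<open>g\<close> and \<open>x\<close> has a side
  \<open>A\<close> containing \<open>g\<close>, and the half-space over \<open>A\<close> based at
  \<open>f\<close> contains the first point but not the second. This injects the walls counted on
  the left, with multiplicity, into those on the right.\<close>

lemma wall_dist_le_wreath_wall_dist:
  assumes m: "space_with_walls (carrier G) m"
    and v: "(f, g) \<in> carrier W" and w: "(f', g') \<in> carrier W"
    and x: "x \<in> carrier G" "x = g' \<or> f x \<noteq> f' x"
  shows "wall_dist m g x \<le> wall_dist (wreath_walls m) (f, g) (f', g')"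
proof -
  have c: "f \<in> carrier base" "g \<in> carrier G" using v by (auto simp: carrier_wreath)
  define side where "side = (\<lambda>P::'g set set. THE A. A \<in> P \<and> g \<in> A)"
  have side: "P = {side P, carrier G - side P}" "side P \<subseteq> carrier G" "g \<in> side P"
    if P: "is_wall (carrier G) P" for P
  proof -
    obtain A where A: "A \<in> P" "g \<in> A" using wall_side[OF P c(2)] .
    then have "P = {A, carrier G - A}" "A \<subseteq> carrier G" using is_wallD[OF P] by blast+
    moreover from this A have "side P = A" unfolding side_def by (intro the_equality) auto
    ultimately show "P = {side P, carrier G - side P}" "side P \<subseteq> carrier G" "g \<in> side P"
      using A by auto
  qed
  define lift where "lift = (\<lambda>(P, k::nat).
    ({halfspace (side P) f, carrier W - halfspace (side P) f}, k))"
  have sepD: "is_wall (carrier G) P" "k < m P" "x \<notin> side P"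
    if "(P, k) \<in> separating_walls m g x" for P k
  proof -
    show P: "is_wall (carrier G) P" and "k < m P"
      using that m by (auto simp: separating_walls_def space_with_walls_def)
    have "side P \<in> P" using side(1)[OF P] by blast
    then show "x \<notin> side P"
      using that separates_iff[OF P _ c(2) x(1)] side(3)[OF P] by (auto simp: separating_walls_def)
  qed
  \<comment> \<open>Of the two sides of a lifted wall, the half-space is the one containing
    \<open>(f, g)\<close>; its projection to \<open>G\<close> returns \<open>side P\<close>, which
    determines \<open>P\<close>.\<close>
  have "inj_on lift (separating_walls m g x)"
  proof (rule inj_onI, clarify)
    fix P k Q l
    assume P: "(P, k) \<in> separating_walls m g x" and Q: "(Q, l) \<in> separating_walls m g x"
      and "lift (P, k) = lift (Q, l)"
    then have eq: "{halfspace (side P) f, carrier W - halfspace (side P) f} =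
        {halfspace (side Q) f, carrier W - halfspace (side Q) f}" and "k = l"
      by (auto simp: lift_def)
    have "(f, g) \<in> halfspace (side P) f" "(f, g) \<in> halfspace (side Q) f"
      using side(3)[OF sepD(1)[OF P]] side(3)[OF sepD(1)[OF Q]] c by (auto simp: halfspace_def)
    with eq have "halfspace (side P) f = halfspace (side Q) f" by blast
    then have "side P = side Q" using snd_halfspace[OF c(1)] by metis
    then show "P = Q \<and> k = l"
      using side(1)[OF sepD(1)[OF P]] side(1)[OF sepD(1)[OF Q]] \<open>k = l\<close> by simp
  qed
  moreover have "lift ` separating_walls m g x \<subseteq>
      separating_walls (wreath_walls m) (f, g) (f', g')"
  proof (rule image_subsetI)
    fix p assume "p \<in> separating_walls m g x"
    moreover obtain P k where p: "p = (P, k)" by (cases p)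
    ultimately have P: "(P, k) \<in> separating_walls m g x" by simp
    note wall = sepD(1)[OF P]
    let ?E = "halfspace (side P) f"
    let ?P = "{?E, carrier W - ?E}"
    have wallE: "is_wall (carrier W) ?P"
      using wall side(1)[OF wall] c by (intro is_wall_halfspace) simp_all
    have "?E \<in> halfspaces" using side(2)[OF wall] c unfolding halfspaces_def by blast
    then have "halfspace_multiplicity m ?E = m P"
      using side(1)[OF wall] c by (simp add: halfspace_multiplicity_def snd_halfspace)
    \<comment> \<open>The lifted wall has at least the multiplicity of \<open>P\<close>, so the
      index \<open>k\<close> still denotes an occurrence.\<close>
    moreover have "halfspace_multiplicity m ?E \<le> (\<Sum>E\<in>?P. halfspace_multiplicity m E)"
      by (rule member_le_sum) auto
    ultimately have "k < wreath_walls m ?P"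
      using sepD(2)[OF P] wallE by (simp add: wreath_walls_def)
    moreover have "(f, g) \<in> ?E" using side(3)[OF wall] c by (simp add: halfspace_def)
    \<comment> \<open>As \<open>x\<close> lies outside \<open>side P\<close>, either
      \<open>g' = x\<close> does, or \<open>f'\<close> differs from \<open>f\<close> at a point
      outside \<open>side P\<close>.\<close>
    moreover have "(f', g') \<notin> ?E" using sepD(3)[OF P] x by (auto simp: halfspace_def intro!: bexI[of _ x])
    ultimately show "lift p \<in> separating_walls (wreath_walls m) (f, g) (f', g')"
      using separates_iff[OF wallE _ v w, of ?E] by (simp add: p separating_walls_def lift_def)
  qed
  ultimately show ?thesis
    unfolding wall_dist_def
    by (rule card_inj_on_le) (rule finite_separating_walls[OF space_with_walls_wreath[OF m] v w])
qed

lemma proper_wreath_walls: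
  assumes m: "space_with_walls (carrier G) m" "proper_wall_dist (carrier G) m"
    and fin: "finite (carrier H)"
  shows "proper_wall_dist (carrier W) (wreath_walls m)"
  unfolding proper_wall_dist_def
proof (intro allI impI)
  fix B assume B: "B \<subseteq> carrier W"
    and "\<exists>N. \<forall>v\<in>B. \<forall>w\<in>B. wall_dist (wreath_walls m) v w \<le> N"
  then obtain N where N: "\<And>v w. \<lbrakk>v \<in> B; w \<in> B\<rbrakk> \<Longrightarrow> wall_dist (wreath_walls m) v w \<le> N"
    by blast
  show "finite B"
  proof (cases "B = {}")
    case False
    then obtain f g where fg: "(f, g) \<in> B" by auto
    then have c: "f \<in> carrier base" "g \<in> carrier G" using B by (auto simp: carrier_wreath)
    define F where "F = {x \<in> carrier G. wall_dist m g x \<le> N}"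
    have "finite F" unfolding F_def by (rule finite_wall_ball[OF m c(2)])
    \<comment> \<open>Points of \<open>B\<close> will have their group component in the ball
      \<open>F\<close> and a function equal to \<open>f\<close> off \<open>F\<close>; finiteness of
      \<open>H\<close> leaves finitely many choices on \<open>F\<close>.\<close>
    let ?C = "(\<lambda>h x. if x \<in> F then h x else f x) ` (F \<rightarrow>\<^sub>E carrier H) \<times> F"
    have "B \<subseteq> ?C"
    proof clarify
      fix f' g' assume w: "(f', g') \<in> B"
      then have c': "f' \<in> carrier base" "g' \<in> carrier G" using B by (auto simp: carrier_wreath)
      have F: "x \<in> F" if "x \<in> carrier G" "x = g' \<or> f x \<noteq> f' x" for x
        using wall_dist_le_wreath_wall_dist[OF m(1) subsetD[OF B fg] subsetD[OF B w] that]
          N[OF fg w] that by (simp add: F_def)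
      have "f x = f' x" if "x \<notin> F" for x
      proof (cases "x \<in> carrier G")
        case True
        with that F[of x] show ?thesis by blast
      next
        case False
        \<comment> \<open>Off \<open>carrier G\<close> both functions take the default value of
          extensional functions.\<close>
        with c(1) c'(1) show ?thesis
          unfolding carrier_base by (simp add: PiE_arb[where S = "carrier G" and T = "\<lambda>_. carrier H"])
      qed
      then have "f' = (\<lambda>x. if x \<in> F then restrict f' F x else f x)" by (auto simp: fun_eq_iff)
      moreover have "restrict f' F \<in> F \<rightarrow>\<^sub>E carrier H"
        using base_closed[OF c'(1)] by (auto simp: F_def)
      ultimately show "f' \<in> (\<lambda>h x. if x \<in> F then h x else f x) ` (F \<rightarrow>\<^sub>E carrier H) \<and> g' \<in> F"
        using F[of g'] c' by blast
    qed
    moreover have "finite ?C" using \<open>finite F\<close> fin by (simp add: finite_PiE)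
    ultimately show ?thesis by (rule finite_subset)
  qed simp
qed

end

lemma class_PW_wreath_product:
  assumes "group H" "finite (carrier H)" "class_PW G"
  shows "class_PW (wreath_product H G)"
proof -
  obtain m where G: "group G" "countable (carrier G)"
    and m: "space_with_walls (carrier G) m" "left_invariant_walls G m"
      "proper_wall_dist (carrier G) m"
    using assms(3) unfolding class_PW_def by blast
  have "countable (carrier H)" using assms(2) by (rule countable_finite)
  then show ?thesis
    unfolding class_PW_def
    using group_wreath[OF assms(1) G(1)] countable_wreath[OF assms(1) G(1) G(2)]
      space_with_walls_wreath[OF assms(1) G(1) m(1)]
      left_invariant_wreath_walls[OF assms(1) G(1) m(1,2)]
      proper_wreath_walls[OF assms(1) G(1) m(1,3) assms(2)]
    by blast
qed

section \<open>Affine \<open>l\<^sup>2\<close> spaces\<close>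

definition square_summable :: "('i \<Rightarrow> real) \<Rightarrow> bool" where
  "square_summable f \<longleftrightarrow> (\<lambda>i. (f i)\<^sup>2) summable_on UNIV"

text \<open>The infinite sum defaults to 0 on families that are not summable, so this is a norm only
  together with \<open>square_summable\<close>.\<close>

definition l2_norm :: "('i \<Rightarrow> real) \<Rightarrow> real" where
  "l2_norm f = sqrt (\<Sum>\<^sub>\<infinity>i. (f i)\<^sup>2)"

lemma square_summable_bounded:
  assumes "\<And>F. finite F \<Longrightarrow> (\<Sum>i\<in>F. (f i)\<^sup>2) \<le> C"
  shows "square_summable f"
  unfolding square_summable_def
  by (rule nonneg_bounded_partial_sums_imp_summable_on[of _ _ C])
    (auto intro: eventually_finite_subsets_at_top_weakI assms)

lemma l2_norm_nonneg: "0 \<le> l2_norm f"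
  by (simp add: l2_norm_def infsum_nonneg)

lemma L2_set_le_l2_norm:
  assumes "square_summable f" "finite F"
  shows "L2_set f F \<le> l2_norm f"
  unfolding L2_set_def l2_norm_def real_sqrt_le_iff
  using assms by (intro finite_sum_le_infsum) (auto simp: square_summable_def)

text \<open>Carries bounds on finite sections over to the whole family, summability included; the
  triangle inequality and completeness both rest on it.\<close>

lemma l2_norm_le:
  assumes "\<And>F. finite F \<Longrightarrow> L2_set f F \<le> C"
  shows "square_summable f" "l2_norm f \<le> C"
proof -
  have "0 \<le> C" using assms[of "{}"] by simp
  have *: "(\<Sum>i\<in>F. (f i)\<^sup>2) \<le> C\<^sup>2" if "finite F" for F
    using assms[OF that] by (simp add: L2_set_def sqrt_le_D)
  then show "square_summable f" by (rule square_summable_bounded)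
  then have "(\<Sum>\<^sub>\<infinity>i. (f i)\<^sup>2) \<le> C\<^sup>2"
    by (intro infsum_le_finite_sums) (auto simp: square_summable_def *)
  then show "l2_norm f \<le> C"
    using \<open>0 \<le> C\<close> by (simp add: l2_norm_def real_le_lsqrt)
qed

lemma l2_norm_triangle:
  assumes "square_summable f" "square_summable g"
  shows "square_summable (\<lambda>i. f i + g i)" "l2_norm (\<lambda>i. f i + g i) \<le> l2_norm f + l2_norm g"
proof -
  have *: "L2_set (\<lambda>i. f i + g i) F \<le> l2_norm f + l2_norm g" if "finite F" for F
    using L2_set_triangle_ineq[of f g F] L2_set_le_l2_norm[OF assms(1) that]
      L2_set_le_l2_norm[OF assms(2) that] by linarith
  show "square_summable (\<lambda>i. f i + g i)" "l2_norm (\<lambda>i. f i + g i) \<le> l2_norm f + l2_norm g"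
    by (rule l2_norm_le[OF *]; assumption)+
qed

lemma square_summable_scale:
  assumes "square_summable f"
  shows "square_summable (\<lambda>i. a * f i)"
  using summable_on_cmult_right[of "\<lambda>i. (f i)\<^sup>2" UNIV "a\<^sup>2"] assms
  by (simp add: square_summable_def power_mult_distrib)

lemma square_summable_diff:
  assumes "square_summable f" "square_summable g"
  shows "square_summable (\<lambda>i. f i - g i)"
  using l2_norm_triangle(1)[OF assms(1) square_summable_scale[OF assms(2), of "-1"]] by simp

lemma square_summable_finite_support:
  assumes "finite {i. f i \<noteq> 0}"
  shows "square_summable f"
  unfolding square_summable_def
  by (rule finite_nonzero_values_imp_summable_on) (use assms in simp)

lemma summable_on_mult_square_summable:
  assumes "square_summable f" "square_summable g"
  shows "(\<lambda>i. f i * g i) summable_on UNIV"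
proof -
  \<comment> \<open>Twice the product is already bounded by the sum of squares.\<close>
  have "norm (f i * g i) \<le> (f i)\<^sup>2 + (g i)\<^sup>2" for i
    using sum_squares_bound[of "\<bar>f i\<bar>" "\<bar>g i\<bar>"] zero_le_power2[of "f i"] zero_le_power2[of "g i"]
    unfolding real_norm_def abs_mult power2_abs by linarith
  moreover have "(\<lambda>i. (f i)\<^sup>2 + (g i)\<^sup>2) summable_on UNIV"
    using assms by (intro summable_on_add) (auto simp: square_summable_def)
  ultimately have "(\<lambda>i. f i * g i) abs_summable_on UNIV"
    using summable_on_comparison_test[of "\<lambda>i. (f i)\<^sup>2 + (g i)\<^sup>2" UNIV "\<lambda>i. norm (f i * g i)"]
      norm_ge_zero by blast
  then show ?thesis by (rule abs_summable_summable)
qed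

lemma l2_norm_eq_0_iff:
  assumes "square_summable f"
  shows "l2_norm f = 0 \<longleftrightarrow> (\<forall>i. f i = 0)"
proof
  assume "l2_norm f = 0"
  then show "\<forall>i. f i = 0"
    using nonneg_infsum_le_0D[of "\<lambda>i. (f i)\<^sup>2" UNIV] assms
    by (simp add: l2_norm_def square_summable_def)
qed (simp add: l2_norm_def)

lemma l2_norm_minus_commute: "l2_norm (\<lambda>i. f i - g i) = l2_norm (\<lambda>i. g i - f i)"
  by (simp add: l2_norm_def power2_commute)

lemma abs_le_l2_norm:
  assumes "square_summable f"
  shows "\<bar>f i\<bar> \<le> l2_norm f"
  using L2_set_le_l2_norm[OF assms, of "{i}"] by simp

text \<open>The affine space \<open>c + l\<^sup>2\<close> with origin \<open>c\<close>. A permutation \<open>\<sigma>\<close> of the indices such that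
  \<open>c \<circ> \<sigma> - c\<close> is square summable acts on it isometrically by \<open>f \<mapsto> f \<circ> \<sigma>\<close>, so that no cocycle
  has to be mentioned.\<close>

definition affine_l2 :: "('i \<Rightarrow> real) \<Rightarrow> (real, 'i \<Rightarrow> real) module" where
  "affine_l2 c = \<lparr>carrier = {f. square_summable (\<lambda>i. f i - c i)}, monoid.mult = undefined, one = undefined,
     zero = c, add = (\<lambda>f g i. f i + g i - c i), smult = (\<lambda>a f i. c i + a * (f i - c i))\<rparr>"

definition affine_l2_ip :: "('i \<Rightarrow> real) \<Rightarrow> ('i \<Rightarrow> real) \<Rightarrow> ('i \<Rightarrow> real) \<Rightarrow> real" where
  "affine_l2_ip c f g = (\<Sum>\<^sub>\<infinity>i. (f i - c i) * (g i - c i))"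

lemma affine_l2_simps [simp]:
  "carrier (affine_l2 c) = {f. square_summable (\<lambda>i. f i - c i)}"
  "\<zero>\<^bsub>affine_l2 c\<^esub> = c"
  "f \<oplus>\<^bsub>affine_l2 c\<^esub> g = (\<lambda>i. f i + g i - c i)"
  "a \<odot>\<^bsub>affine_l2 c\<^esub> f = (\<lambda>i. c i + a * (f i - c i))"
  by (simp_all add: affine_l2_def)

section \<open>Hilbert space axioms for the affine space\<close>

lemma cring_real_ring: "cring real_ring"
proof (rule cringI)
  show "abelian_group real_ring"
  proof (rule abelian_groupI)
    fix x assume "x \<in> carrier real_ring"
    show "\<exists>y\<in>carrier real_ring. y \<oplus>\<^bsub>real_ring\<^esub> x = \<zero>\<^bsub>real_ring\<^esub>"
      by (intro bexI[of _ "-x"]) (auto simp: real_ring_def)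
  qed (auto simp: real_ring_def)
  show "Group.comm_monoid real_ring"
    by (rule comm_monoidI) (auto simp: real_ring_def)
qed (auto simp: real_ring_def algebra_simps)

lemma square_summable_diff_base:
  assumes "square_summable (\<lambda>i. f i - c i)" "square_summable (\<lambda>i. g i - c i)"
  shows "square_summable (\<lambda>i. f i - g i)"
  using square_summable_diff[OF assms] by simp

lemma module_affine_l2: "Module.module real_ring (affine_l2 c)"
proof (rule module.intro)
  show "cring real_ring" by (rule cring_real_ring)
  show "abelian_group (affine_l2 c)"
  proof (rule abelian_groupI)
    fix f g assume "f \<in> carrier (affine_l2 c)" "g \<in> carrier (affine_l2 c)"
    then show "f \<oplus>\<^bsub>affine_l2 c\<^esub> g \<in> carrier (affine_l2 c)"
      using l2_norm_triangle(1)[of "\<lambda>i. f i - c i" "\<lambda>i. g i - c i"] by (simp add: algebra_simps)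
  next
    fix f assume f: "f \<in> carrier (affine_l2 c)"
    \<comment> \<open>The negative of \<open>f\<close> is its reflection in the origin
      \<open>c\<close>.\<close>
    then show "\<exists>g\<in>carrier (affine_l2 c). g \<oplus>\<^bsub>affine_l2 c\<^esub> f = \<zero>\<^bsub>affine_l2 c\<^esub>"
      using square_summable_scale[of "\<lambda>i. f i - c i" "-1"]
      by (intro bexI[of _ "\<lambda>i. c i - (f i - c i)"]) auto
  qed (auto simp: algebra_simps square_summable_finite_support)
  show "module_axioms real_ring (affine_l2 c)"
  proof (rule module_axioms.intro)
    fix a f assume "f \<in> carrier (affine_l2 c)"
    then show "a \<odot>\<^bsub>affine_l2 c\<^esub> f \<in> carrier (affine_l2 c)"
      by (simp add: square_summable_scale)
  qed (auto simp: real_ring_def algebra_simps)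
qed

lemma a_minus_affine_l2:
  assumes "f \<in> carrier (affine_l2 c)" "g \<in> carrier (affine_l2 c)"
  shows "f \<ominus>\<^bsub>affine_l2 c\<^esub> g = (\<lambda>i. f i - g i + c i)"
proof -
  interpret V: Module.module real_ring "affine_l2 c" by (rule module_affine_l2)
  have "(\<lambda>i. f i - g i + c i) \<in> carrier (affine_l2 c)"
    using square_summable_diff_base[of f c g] assms by simp
  \<comment> \<open>The abstract negative need not be computed: adding \<open>g\<close> to the
    claimed difference gives \<open>f\<close>, and subtracting \<open>g\<close> again
    cancels.\<close>
  then have "(\<lambda>i. f i - g i + c i) \<oplus>\<^bsub>affine_l2 c\<^esub> g \<ominus>\<^bsub>affine_l2 c\<^esub> g = (\<lambda>i. f i - g i + c i)"
    using assms(2) unfolding a_minus_def by (simp only: V.a_assoc V.r_neg V.r_zero V.a_inv_closed)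
  then show ?thesis by simp
qed

lemma hilbert_dist_affine_l2:
  assumes "f \<in> carrier (affine_l2 c)" "g \<in> carrier (affine_l2 c)"
  shows "hilbert_dist (affine_l2 c) (affine_l2_ip c) f g = l2_norm (\<lambda>i. f i - g i)"
  unfolding hilbert_dist_def a_minus_affine_l2[OF assms]
  using assms by (simp add: affine_l2_ip_def l2_norm_def power2_eq_square)

lemma Metric_space_affine_l2:
  "Metric_space (carrier (affine_l2 c)) (hilbert_dist (affine_l2 c) (affine_l2_ip c))"
proof
  fix f g
  show "0 \<le> hilbert_dist (affine_l2 c) (affine_l2_ip c) f g"
  \<comment> \<open>Nonnegativity and symmetry are required at all arguments; unless both lie in the
    carrier, the distance is 0 by definition.\<close>
  proof (cases "f \<in> carrier (affine_l2 c) \<and> g \<in> carrier (affine_l2 c)")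
    case True
    then show ?thesis by (simp only: hilbert_dist_affine_l2 l2_norm_nonneg)
  next
    case False
    then show ?thesis by (auto simp: hilbert_dist_def)
  qed
  show "hilbert_dist (affine_l2 c) (affine_l2_ip c) f g =
      hilbert_dist (affine_l2 c) (affine_l2_ip c) g f"
  proof (cases "f \<in> carrier (affine_l2 c) \<and> g \<in> carrier (affine_l2 c)")
    case True
    then show ?thesis by (simp only: hilbert_dist_affine_l2 l2_norm_minus_commute[of f g])
  next
    case False
    then show ?thesis by (auto simp: hilbert_dist_def)
  qed
next
  fix f g assume fg: "f \<in> carrier (affine_l2 c)" "g \<in> carrier (affine_l2 c)"
  then show "hilbert_dist (affine_l2 c) (affine_l2_ip c) f g = 0 \<longleftrightarrow> f = g"
    unfolding hilbert_dist_affine_l2[OF fg]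
    using square_summable_diff_base[of f c g] by (subst l2_norm_eq_0_iff) auto
next
  fix f g h
  assume fgh: "f \<in> carrier (affine_l2 c)" "g \<in> carrier (affine_l2 c)" "h \<in> carrier (affine_l2 c)"
  then show "hilbert_dist (affine_l2 c) (affine_l2_ip c) f h \<le>
      hilbert_dist (affine_l2 c) (affine_l2_ip c) f g +
      hilbert_dist (affine_l2 c) (affine_l2_ip c) g h"
    unfolding hilbert_dist_affine_l2[OF fgh(1,2)] hilbert_dist_affine_l2[OF fgh(2,3)]
      hilbert_dist_affine_l2[OF fgh(1,3)]
    using l2_norm_triangle(2)[OF square_summable_diff_base[of f c g]
        square_summable_diff_base[of g c h]] by simp
qed

text \<open>Coordinates are dominated by the norm, so they converge. On a finite section the Cauchy
  bound survives the limit in one index, and finite sections control the norm. Only differences are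
  assumed square summable, because the sequence will lie in an affine space.\<close>

lemma l2_complete:
  fixes s :: "nat \<Rightarrow> 'i \<Rightarrow> real"
  assumes s: "\<And>m n. square_summable (\<lambda>i. s m i - s n i)"
    and Cauchy: "\<And>e. e > 0 \<Longrightarrow> \<exists>N. \<forall>m\<ge>N. \<forall>n\<ge>N. l2_norm (\<lambda>i. s m i - s n i) < e"
  obtains f where "\<And>n. square_summable (\<lambda>i. s n i - f i)"
    "(\<lambda>n. l2_norm (\<lambda>i. s n i - f i)) \<longlonglongrightarrow> 0"
proof -
  have "convergent (\<lambda>n. s n i)" for i
  proof (rule real_Cauchy_convergent, rule CauchyI)
    fix e :: real assume "e > 0"
    then obtain N where "\<forall>m\<ge>N. \<forall>n\<ge>N. l2_norm (\<lambda>i. s m i - s n i) < e" using Cauchy by blast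
    then show "\<exists>M. \<forall>m\<ge>M. \<forall>n\<ge>M. norm (s m i - s n i) < e"
      using abs_le_l2_norm[OF s] by (metis le_less_trans real_norm_def)
  qed
  then obtain f where f: "\<And>i. (\<lambda>n. s n i) \<longlonglongrightarrow> f i"
    unfolding convergent_def by metis
  have bound: "\<exists>N. \<forall>n\<ge>N. square_summable (\<lambda>i. s n i - f i) \<and> l2_norm (\<lambda>i. s n i - f i) \<le> e"
    if "e > 0" for e
  proof -
    obtain N where N: "\<forall>m\<ge>N. \<forall>n\<ge>N. l2_norm (\<lambda>i. s m i - s n i) < e"
      using Cauchy[OF \<open>e > 0\<close>] by blast
    have L2: "L2_set (\<lambda>i. s n i - f i) F \<le> e" if "n \<ge> N" "finite F" for n F
    proof (rule LIMSEQ_le_const2)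
      show "(\<lambda>m. L2_set (\<lambda>i. s n i - s m i) F) \<longlonglongrightarrow> L2_set (\<lambda>i. s n i - f i) F"
        unfolding L2_set_def by (intro tendsto_intros f)
      show "\<exists>M. \<forall>m\<ge>M. L2_set (\<lambda>i. s n i - s m i) F \<le> e"
        using N \<open>n \<ge> N\<close> L2_set_le_l2_norm[OF s \<open>finite F\<close>, of n]
        by (meson less_imp_le order_trans)
    qed
    show ?thesis using l2_norm_le[OF L2] by blast
  qed
  show thesis
  proof (rule that)
    fix n
    obtain N where "square_summable (\<lambda>i. s N i - f i)"
      using bound[of 1] by auto
    from l2_norm_triangle(1)[OF s[of n N] this] show "square_summable (\<lambda>i. s n i - f i)" by simp
  next
    show "(\<lambda>n. l2_norm (\<lambda>i. s n i - f i)) \<longlonglongrightarrow> 0"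
    proof (rule LIMSEQ_I)
      fix r :: real assume "r > 0"
      \<comment> \<open>The limit leaves a non-strict bound; halving \<open>r\<close> makes it
        strict.\<close>
      then obtain N where "\<forall>n\<ge>N. l2_norm (\<lambda>i. s n i - f i) \<le> r / 2"
        using bound[of "r / 2"] by auto
      then show "\<exists>N. \<forall>n\<ge>N. norm (l2_norm (\<lambda>i. s n i - f i) - 0) < r"
        using \<open>r > 0\<close> by (intro exI[of _ N]) (force simp: l2_norm_nonneg)
    qed
  qed
qed

lemma mcomplete_affine_l2:
  "Metric_space.mcomplete (carrier (affine_l2 c)) (hilbert_dist (affine_l2 c) (affine_l2_ip c))"
proof -
  let ?V = "affine_l2 c" and ?d = "hilbert_dist (affine_l2 c) (affine_l2_ip c)"
  interpret Metric_space "carrier ?V" ?d by (rule Metric_space_affine_l2)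
  show ?thesis
    unfolding mcomplete_def
  proof (intro allI impI)
    fix s assume "MCauchy s"
    then have s: "\<And>n. s n \<in> carrier ?V"
      and C: "\<And>e. e > 0 \<Longrightarrow> \<exists>N. \<forall>m n. N \<le> m \<longrightarrow> N \<le> n \<longrightarrow> ?d (s m) (s n) < e"
      unfolding MCauchy_def by blast+
    obtain f where f: "\<And>n. square_summable (\<lambda>i. s n i - f i)"
        "(\<lambda>n. l2_norm (\<lambda>i. s n i - f i)) \<longlonglongrightarrow> 0"
    proof (rule l2_complete)
      show "square_summable (\<lambda>i. s m i - s n i)" for m n
        using square_summable_diff_base[of "s m" c "s n"] s by simp
      show "\<exists>N. \<forall>m\<ge>N. \<forall>n\<ge>N. l2_norm (\<lambda>i. s m i - s n i) < e" if "e > 0" for e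
        using C[OF that] by (simp only: hilbert_dist_affine_l2[OF s s]) blast
    qed blast
    \<comment> \<open>\<open>f - c\<close> is the difference of \<open>s 0 - c\<close> and
      \<open>s 0 - f\<close>.\<close>
    have "square_summable (\<lambda>i. f i - c i)"
      using square_summable_diff[of "\<lambda>i. s 0 i - c i" "\<lambda>i. s 0 i - f i"] f(1) s by simp
    then have fV: "f \<in> carrier ?V" by simp
    with f(2) have "limitin mtopology s f sequentially"
      unfolding limitin_metric_dist_null by (simp only: hilbert_dist_affine_l2[OF s fV]) (use s in simp)
    then show "\<exists>f. limitin mtopology s f sequentially" by blast
  qed
qed

lemma real_hilbert_space_affine_l2: "real_hilbert_space (affine_l2 c) (affine_l2_ip c)"
proof (rule real_hilbert_space.intro)
  show "Module.module real_ring (affine_l2 c)" by (rule module_affine_l2)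
  show "real_hilbert_space_axioms (affine_l2 c) (affine_l2_ip c)"
  proof
    fix f g assume fg: "f \<in> carrier (affine_l2 c)" "g \<in> carrier (affine_l2 c)"
    show "affine_l2_ip c f g = affine_l2_ip c g f"
      by (simp add: affine_l2_ip_def mult.commute)
    show "affine_l2_ip c (a \<odot>\<^bsub>affine_l2 c\<^esub> f) g = a * affine_l2_ip c f g" for a
      by (simp add: affine_l2_ip_def mult.assoc infsum_cmult_right')
  next
    fix f g h
    assume fgh: "f \<in> carrier (affine_l2 c)" "g \<in> carrier (affine_l2 c)"
      "h \<in> carrier (affine_l2 c)"
    have "affine_l2_ip c (f \<oplus>\<^bsub>affine_l2 c\<^esub> g) h =
        (\<Sum>\<^sub>\<infinity>i. (f i - c i) * (h i - c i) + (g i - c i) * (h i - c i))"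
      by (simp add: affine_l2_ip_def algebra_simps)
    also have "\<dots> = affine_l2_ip c f h + affine_l2_ip c g h"
      unfolding affine_l2_ip_def
      using fgh by (intro infsum_add summable_on_mult_square_summable) auto
    finally show "affine_l2_ip c (f \<oplus>\<^bsub>affine_l2 c\<^esub> g) h = affine_l2_ip c f h + affine_l2_ip c g h" .
  next
    fix f assume f: "f \<in> carrier (affine_l2 c)" "f \<noteq> \<zero>\<^bsub>affine_l2 c\<^esub>"
    then have "l2_norm (\<lambda>i. f i - c i) \<noteq> 0"
      by (subst l2_norm_eq_0_iff) auto
    moreover have "l2_norm (\<lambda>i. f i - c i) = sqrt (affine_l2_ip c f f)"
      by (simp add: l2_norm_def affine_l2_ip_def power2_eq_square)
    ultimately show "affine_l2_ip c f f > 0"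
      using l2_norm_nonneg[of "\<lambda>i. f i - c i"] by auto
  qed (rule mcomplete_affine_l2)
qed

section \<open>Wall structures and the Haagerup property\<close>

text \<open>\<open>G\<close> permutes the coordinates of the affine space through the indicator
  \<open>c\<close> of \<open>S\<close>. By \<open>fin\<close>, each \<open>g\<close> changes
  \<open>c\<close> at finitely many coordinates, so the space is preserved. The squared displacement
  of \<open>c\<close> bounds the number of changed coordinates, so \<open>proper\<close> makes the
  action metrically proper. Coordinates in \<open>nat\<close> place the space in the type that
  \<open>haagerup\<close> prescribes.\<close>

lemma haagerup_if_permutation_action:
  fixes G :: "('g, 'b) monoid_scheme" (structure)
    and \<sigma> :: "'g \<Rightarrow> nat \<Rightarrow> nat" and S :: "nat set"
  assumes G: "group G" "countable (carrier G)"
    and one: "\<And>n. \<sigma> \<one> n = n"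
    and mult: "\<And>g h n. \<lbrakk>g \<in> carrier G; h \<in> carrier G\<rbrakk> \<Longrightarrow> \<sigma> (g \<otimes> h) n = \<sigma> g (\<sigma> h n)"
    and fin: "\<And>g. g \<in> carrier G \<Longrightarrow> finite {n. (\<sigma> g n \<in> S) \<noteq> (n \<in> S)}"
    and proper: "\<And>N. finite {g \<in> carrier G. card {n. (\<sigma> (inv g) n \<in> S) \<noteq> (n \<in> S)} \<le> N}"
  shows "haagerup G"
proof -
  interpret group G by (rule G(1))
  define c :: "nat \<Rightarrow> real" where "c = indicator S"
  let ?V = "affine_l2 c" and ?d = "hilbert_dist (affine_l2 c) (affine_l2_ip c)"
  \<comment> \<open>Precomposition reverses products, which the inverse undoes. The restriction
    makes \<open>\<phi> g\<close> extensional, as \<open>Bij\<close> requires.\<close>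
  define \<phi> :: "'g \<Rightarrow> (nat \<Rightarrow> real) \<Rightarrow> nat \<Rightarrow> real"
    where "\<phi> = (\<lambda>g. \<lambda>f\<in>carrier ?V. f \<circ> \<sigma> (inv g))"
  have bij: "bij (\<sigma> g)" if g: "g \<in> carrier G" for g
  proof (rule o_bij)
    show "\<sigma> (inv g) \<circ> \<sigma> g = id" "\<sigma> g \<circ> \<sigma> (inv g) = id"
      using g by (auto simp: fun_eq_iff one simp flip: mult)
  qed
  have ss: "square_summable (f \<circ> \<sigma> g) \<longleftrightarrow> square_summable f"
    and norm: "l2_norm (f \<circ> \<sigma> g) = l2_norm f" if "g \<in> carrier G" for g and f :: "nat \<Rightarrow> real"
    using summable_on_reindex_bij_betw[OF bij[OF that], of "\<lambda>i. (f i)\<^sup>2"]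
      infsum_reindex_bij_betw[OF bij[OF that], of "\<lambda>i. (f i)\<^sup>2"]
    by (simp_all add: square_summable_def l2_norm_def)
  have closed: "f \<circ> \<sigma> g \<in> carrier ?V" if f: "f \<in> carrier ?V" and g: "g \<in> carrier G" for f g
  proof -
    \<comment> \<open>\<open>f \<circ> \<sigma> g - c\<close> is the sum of
      \<open>(f - c) \<circ> \<sigma> g\<close> and the finitely supported
      \<open>c \<circ> \<sigma> g - c\<close>.\<close>
    have "{n. c (\<sigma> g n) - c n \<noteq> 0} = {n. (\<sigma> g n \<in> S) \<noteq> (n \<in> S)}"
      by (auto simp: c_def indicator_def)
    then have "square_summable (\<lambda>n. c (\<sigma> g n) - c n)"
      using fin[OF g] by (intro square_summable_finite_support) simp
    moreover have "square_summable (\<lambda>n. f (\<sigma> g n) - c (\<sigma> g n))"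
      using ss[OF g, of "\<lambda>n. f n - c n"] f by (simp add: o_def)
    ultimately show ?thesis
      using l2_norm_triangle(1)[of "\<lambda>n. f (\<sigma> g n) - c (\<sigma> g n)" "\<lambda>n. c (\<sigma> g n) - c n"] by simp
  qed
  have \<phi>_closed: "\<phi> g f \<in> carrier ?V" if "g \<in> carrier G" "f \<in> carrier ?V" for g f
    using closed[of f "inv g"] that unfolding \<phi>_def by simp
  have \<phi>_mult: "\<phi> (g \<otimes> h) f = \<phi> g (\<phi> h f)"
    if "g \<in> carrier G" "h \<in> carrier G" "f \<in> carrier ?V" for g h f
    using \<phi>_closed[of h f] that
    by (simp only: \<phi>_def restrict_apply' if_True) (simp add: fun_eq_iff inv_mult_group mult)
  have \<phi>_one: "\<phi> \<one> f = f" if "f \<in> carrier ?V" for f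
    using that by (simp only: \<phi>_def restrict_apply' if_True) (simp add: fun_eq_iff one)
  have \<phi>_Bij: "\<phi> g \<in> Bij (carrier ?V)" if g: "g \<in> carrier G" for g
  proof -
    have "bij_betw (\<phi> g) (carrier ?V) (carrier ?V)"
    proof (rule bij_betw_byWitness[of _ "\<phi> (inv g)"])
      show "\<forall>f\<in>carrier ?V. \<phi> (inv g) (\<phi> g f) = f" "\<forall>f\<in>carrier ?V. \<phi> g (\<phi> (inv g) f) = f"
        using g by (auto simp only: \<phi>_one \<phi>_mult[symmetric] inv_closed l_inv r_inv)
      show "\<phi> g ` carrier ?V \<subseteq> carrier ?V" "\<phi> (inv g) ` carrier ?V \<subseteq> carrier ?V"
        using \<phi>_closed g by blast+
    qed
    then show ?thesis by (simp add: Bij_def \<phi>_def)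
  qed
  have dist: "?d f (\<phi> g f) = l2_norm (\<lambda>n. f n - f (\<sigma> (inv g) n))"
    if "g \<in> carrier G" "f \<in> carrier ?V" for g f
    using hilbert_dist_affine_l2[OF that(2) \<phi>_closed[OF that]] that by (simp add: \<phi>_def)
  have "proper_isometric_action G ?V (affine_l2_ip c) \<phi>"
    unfolding proper_isometric_action_def
  proof (intro conjI ballI)
    show "group_action G (carrier ?V) \<phi>"
    proof (intro group_action.intro group_hom.intro group_hom_axioms.intro homI
        group_BijGroup is_group)
      fix g h assume gh: "g \<in> carrier G" "h \<in> carrier G"
      show "\<phi> g \<in> carrier (BijGroup (carrier ?V))"
        using \<phi>_Bij[OF gh(1)] by (simp add: BijGroup_def)
      have "\<phi> (g \<otimes> h) = compose (carrier ?V) (\<phi> g) (\<phi> h)"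
      proof (rule extensionalityI)
        show "\<phi> (g \<otimes> h) \<in> extensional (carrier ?V)" by (simp add: \<phi>_def)
        show "compose (carrier ?V) (\<phi> g) (\<phi> h) \<in> extensional (carrier ?V)"
          by (rule compose_extensional)
      qed (simp only: \<phi>_mult[OF gh] compose_eq)
      then show "\<phi> (g \<otimes> h) = \<phi> g \<otimes>\<^bsub>BijGroup (carrier ?V)\<^esub> \<phi> h"
        using \<phi>_Bij gh by (simp add: BijGroup_def)
    qed
  next
    fix g f f' assume g: "g \<in> carrier G" and f: "f \<in> carrier ?V" "f' \<in> carrier ?V"
    have "?d (\<phi> g f) (\<phi> g f') = l2_norm ((\<lambda>n. f n - f' n) \<circ> \<sigma> (inv g))"
      unfolding hilbert_dist_affine_l2[OF \<phi>_closed[OF g f(1)] \<phi>_closed[OF g f(2)]]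
      using f by (simp add: \<phi>_def o_def)
    also have "\<dots> = ?d f f'"
      unfolding hilbert_dist_affine_l2[OF f] using g by (simp only: norm inv_closed)
    finally show "?d (\<phi> g f) (\<phi> g f') = ?d f f'" .
  next
    have c: "c \<in> carrier ?V" by (simp add: square_summable_finite_support)
    have "filterlim (\<lambda>g. ?d c (\<phi> g c)) at_top (inf cofinite (principal (carrier G)))"
      unfolding filterlim_at_top eventually_inf_principal eventually_cofinite
    proof
      fix Z :: real
      let ?D = "\<lambda>g. {n. (\<sigma> (inv g) n \<in> S) \<noteq> (n \<in> S)}"
      have "real (card (?D g)) \<le> (?d c (\<phi> g c))\<^sup>2" if g: "g \<in> carrier G" for g
      proof -
        have "finite (?D g)" using fin g by simp
        \<comment> \<open>On \<open>?D g\<close> the difference is 1 or -1, so its squared norm over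
          this set is the cardinality.\<close>
        have "(L2_set (\<lambda>n. c n - c (\<sigma> (inv g) n)) (?D g))\<^sup>2 \<le> (?d c (\<phi> g c))\<^sup>2"
          unfolding dist[OF g c]
          using closed[OF c, of "inv g"] \<open>finite (?D g)\<close> g
            square_summable_diff_base[of c c "c \<circ> \<sigma> (inv g)"] c
          by (intro power_mono L2_set_le_l2_norm L2_set_nonneg) simp_all
        moreover have "(\<Sum>n\<in>?D g. (c n - c (\<sigma> (inv g) n))\<^sup>2) = (\<Sum>n\<in>?D g. 1)"
          by (rule sum.cong) (auto simp: c_def indicator_def)
        ultimately show ?thesis by (simp add: L2_set_def)
      qed
      moreover have "(?d c (\<phi> g c))\<^sup>2 \<le> Z\<^sup>2" if "\<not> Z \<le> ?d c (\<phi> g c)" "g \<in> carrier G" for g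
        using that l2_norm_nonneg unfolding dist[OF that(2) c] by (intro power_mono) auto
      ultimately have "card (?D g) \<le> nat \<lfloor>Z\<^sup>2\<rfloor>" if "\<not> (g \<in> carrier G \<longrightarrow> Z \<le> ?d c (\<phi> g c))" for g
        using that by (fastforce simp: le_nat_floor)
      then have "{g. \<not> (g \<in> carrier G \<longrightarrow> Z \<le> ?d c (\<phi> g c))} \<subseteq>
          {g \<in> carrier G. card (?D g) \<le> nat \<lfloor>Z\<^sup>2\<rfloor>}"
        by blast
      then show "finite {g. \<not> (g \<in> carrier G \<longrightarrow> Z \<le> ?d c (\<phi> g c))}"
        using proper finite_subset by blast
    qed
    with c show "\<exists>x\<^sub>0\<in>carrier ?V. filterlim (\<lambda>g. ?d x\<^sub>0 (\<phi> g x\<^sub>0)) at_top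
        (inf cofinite (principal (carrier G)))"
      by blast
  qed
  with G real_hilbert_space_affine_l2[of c] show ?thesis
    unfolding haagerup_def by blast
qed

text \<open>Indices are the sides of walls, with copies, so each occurrence of a wall contributes
  two. The indices that \<open>g\<close> moves into or out of the set of sides containing the
  identity are those separating the identity from \<open>inv g\<close>.\<close>

lemma haagerup_if_class_PW:
  fixes G :: "('a, 'b) monoid_scheme" (structure)
  assumes "class_PW G"
  shows "haagerup G"
proof -
  obtain m where G: "group G" and countable: "countable (carrier G)"
    and m: "space_with_walls (carrier G) m" "proper_wall_dist (carrier G) m"
    and inv: "left_invariant_walls G m"
    using assms unfolding class_PW_def by blast
  interpret group G by (rule G)
  define J where "J = {(A, k). A \<subseteq> carrier G \<and> k < m {A, carrier G - A}}"
  define sep where "sep = (\<lambda>x y. {j \<in> J. (x \<in> fst j) \<noteq> (y \<in> fst j)})"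
  have J_wall: "is_wall (carrier G) {A, carrier G - A}" if "(A, k) \<in> J" for A k
    using that m(1) unfolding J_def space_with_walls_def by auto
  have sep_iff: "(A, k) \<in> sep x y \<longleftrightarrow>
      A \<subseteq> carrier G \<and> ({A, carrier G - A}, k) \<in> separating_walls m x y"
    if "x \<in> carrier G" "y \<in> carrier G" for x y A k
  proof (cases "(A, k) \<in> J")
    case True
    then show ?thesis
      using separates_iff[OF J_wall[OF True], of A x y] that
      by (auto simp: sep_def separating_walls_def J_def)
  qed (auto simp: sep_def separating_walls_def J_def)
  have fin_sep: "finite (sep x y)" if xy: "x \<in> carrier G" "y \<in> carrier G" for x y
  proof (rule finite_subset)
    show "sep x y \<subseteq> (\<Union>(P, k)\<in>separating_walls m x y. P \<times> {k})"
    proof clarify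
      fix A k assume "(A, k) \<in> sep x y"
      then have "({A, carrier G - A}, k) \<in> separating_walls m x y"
        using sep_iff[OF xy] by blast
      then show "(A, k) \<in> (\<Union>(P, k)\<in>separating_walls m x y. P \<times> {k})"
        by (rule UN_I) simp
    qed
    have "finite P" if "(P, k) \<in> separating_walls m x y" for P k
    proof -
      have "is_wall (carrier G) P"
        using that m(1) by (auto simp: separating_walls_def space_with_walls_def)
      then show ?thesis by (auto simp: is_wall_iff)
    qed
    then show "finite (\<Union>(P, k)\<in>separating_walls m x y. P \<times> {k})"
      using finite_separating_walls[OF m(1) xy] by auto
  qed
  have card_sep: "wall_dist m x y \<le> card (sep x y)"
    if xy: "x \<in> carrier G" "y \<in> carrier G" for x y
  proof -
    \<comment> \<open>Every separating wall is the image of one of its sides.\<close>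
    have "separating_walls m x y \<subseteq> (\<lambda>(A, k). ({A, carrier G - A}, k)) ` sep x y"
    proof clarify
      fix P k assume P: "(P, k) \<in> separating_walls m x y"
      then have "is_wall (carrier G) P"
        using m(1) by (auto simp: separating_walls_def space_with_walls_def)
      then obtain A where "A \<subseteq> carrier G" "P = {A, carrier G - A}"
        by (auto simp: is_wall_iff)
      with P show "(P, k) \<in> (\<lambda>(A, k). ({A, carrier G - A}, k)) ` sep x y"
        by (intro image_eqI[of _ _ "(A, k)"]) (simp_all add: sep_iff[OF xy])
    qed
    then show ?thesis
      unfolding wall_dist_def by (rule surj_card_le[OF fin_sep[OF xy]])
  qed
  \<comment> \<open>A side is nonempty and proper, so it separates some pair of points; there are
    countably many pairs and finitely many sides for each.\<close>
  have "countable J"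
  proof (rule countable_subset)
    show "J \<subseteq> (\<Union>x\<in>carrier G. \<Union>y\<in>carrier G. sep x y)"
    proof clarify
      fix A k assume Ak: "(A, k) \<in> J"
      then obtain x y where "x \<in> carrier G" "y \<in> carrier G" "x \<in> A" "y \<notin> A"
        using is_wallD[OF J_wall[OF Ak], of A] by auto
      with Ak show "(A, k) \<in> (\<Union>x\<in>carrier G. \<Union>y\<in>carrier G. sep x y)"
        by (auto simp: sep_def)
    qed
    show "countable (\<Union>x\<in>carrier G. \<Union>y\<in>carrier G. sep x y)"
      by (intro countable_UN countable countable_finite fin_sep)
  qed
  \<comment> \<open>\<open>J\<close> is numbered to obtain coordinates in \<open>nat\<close>;
    numbers that code no index will be fixed by \<open>\<sigma>\<close>.\<close>
  define e where "e = to_nat_on J"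
  have e_inj: "inj_on e J" unfolding e_def by (rule inj_on_to_nat_on) fact
  define d where "d = inv_into J e"
  have de [simp]: "d (e j) = j" if "j \<in> J" for j
    using e_inj that by (simp add: d_def)
  define act where "act = (\<lambda>g (A :: 'a set, k :: nat). (g <# A, k))"
  have act_J: "act g j \<in> J" if "g \<in> carrier G" "j \<in> J" for g j
    using that left_invariant_halfspace[OF inv m(1)]
    by (auto simp: act_def J_def dest!: l_coset_subset_G[THEN subsetD, rotated 2])
  define \<sigma> where "\<sigma> = (\<lambda>g n. if n \<in> e ` J then e (act g (d n)) else n)"
  define S where "S = {e j |j. j \<in> J \<and> \<one> \<in> fst j}"
  have S_iff: "e j \<in> S \<longleftrightarrow> \<one> \<in> fst j" if "j \<in> J" for j
    using that inj_onD[OF e_inj] unfolding S_def by blast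
  have act_one: "\<one> \<in> fst (act g j) \<longleftrightarrow> inv g \<in> fst j" if "g \<in> carrier G" "j \<in> J" for g j
    using that by (auto simp: act_def J_def mem_l_coset_iff_inv)
  have diff: "{n. (\<sigma> g n \<in> S) \<noteq> (n \<in> S)} = e ` sep \<one> (inv g)" if g: "g \<in> carrier G" for g
  proof (intro subset_antisym subsetI)
    fix n assume n: "n \<in> {n. (\<sigma> g n \<in> S) \<noteq> (n \<in> S)}"
    then obtain j where j: "j \<in> J" "n = e j"
      by (cases "n \<in> e ` J") (auto simp: \<sigma>_def)
    with n g have "(inv g \<in> fst j) \<noteq> (\<one> \<in> fst j)"
      by (simp add: \<sigma>_def S_iff act_J act_one)
    with j show "n \<in> e ` sep \<one> (inv g)" unfolding sep_def by blast
  next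
    fix n assume "n \<in> e ` sep \<one> (inv g)"
    then obtain j where j: "j \<in> J" "n = e j" "(inv g \<in> fst j) \<noteq> (\<one> \<in> fst j)"
      unfolding sep_def by blast
    with g show "n \<in> {n. (\<sigma> g n \<in> S) \<noteq> (n \<in> S)}"
      by (simp add: \<sigma>_def S_iff act_J act_one)
  qed
  show ?thesis
  proof (rule haagerup_if_permutation_action[where \<sigma> = \<sigma> and S = S])
    fix n
    show "\<sigma> \<one> n = n"
      by (auto simp: \<sigma>_def act_def J_def lcos_mult_one split: prod.splits)
  next
    fix g h n assume gh: "g \<in> carrier G" "h \<in> carrier G"
    show "\<sigma> (g \<otimes> h) n = \<sigma> g (\<sigma> h n)"
    proof (cases "n \<in> e ` J")
      case True
      then obtain j where j: "j \<in> J" "n = e j" by blast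
      have "act (g \<otimes> h) j = act g (act h j)"
        using j gh by (auto simp: act_def J_def lcos_m_assoc)
      then show ?thesis using j gh by (simp add: \<sigma>_def act_J)
    qed (simp add: \<sigma>_def)
  next
    fix g assume "g \<in> carrier G"
    then show "finite {n. (\<sigma> g n \<in> S) \<noteq> (n \<in> S)}"
      by (simp only: diff fin_sep finite_imageI one_closed inv_closed)
  next
    fix N
    \<comment> \<open>\<open>diff\<close> at \<open>inv g\<close> gives the sides separating the
      identity from \<open>g\<close>, at least as many as there are separating walls, so such
      \<open>g\<close> lie in a ball.\<close>
    have "wall_dist m \<one> g \<le> N"
      if "g \<in> carrier G" "card {n. (\<sigma> (inv g) n \<in> S) \<noteq> (n \<in> S)} \<le> N" for g
    proof -
      have "card (e ` sep \<one> g) = card (sep \<one> g)"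
        by (rule card_image, rule inj_on_subset[OF e_inj]) (auto simp: sep_def)
      with that card_sep[OF one_closed that(1)] show ?thesis
        by (simp only: diff inv_closed inv_inv)
    qed
    then show "finite {g \<in> carrier G. card {n. (\<sigma> (inv g) n \<in> S) \<noteq> (n \<in> S)} \<le> N}"
      by (intro finite_subset[OF _ finite_wall_ball[OF m one_closed, of N]] subsetI) simp
  qed (use G countable in simp_all)
qed

theorem theorem1:
  fixes H :: "('h, 'c) monoid_scheme" and G :: "('g, 'd) monoid_scheme"
  assumes "group H" and "finite (carrier H)" and "class_PW G"
  shows "class_PW (wreath_product H G) \<and> haagerup (wreath_product H G)"
  using class_PW_wreath_product[OF assms] haagerup_if_class_PW by blast

end
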